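(* Let $(a_i)_{i\ge1}$, $(b_i)_{i\ge2}$ be positive numbers with $\lim_{i\to\infty}b_i/a_i=z_s>0$ and $\lim_{i\to\infty}b_{i+1}/b_i=1$, and let $z>z_s$. Put $Q_1=1$, $Q_i=\frac{a_1a_2\cdots a_{i-1}}{b_2\cdots b_i}$ for $i\ge2$, and assume $$\sum_{m=2}^\infty Q_mz^m\Big(\sum_{k=m}^\infty\frac1{a_kQ_kz^{k+1}}\Big)=\infty .$$ Let $n\ge2$ and let $\Pi^{\mathrm{in}}$ be a probability distribution on $\mathcal E_n$ such that $\mathbf E_{\Pi^{\mathrm{in}}}\big[\sum_{i=2}^\infty C_i\big]<\infty$. Then, for the Becker–Döring process and all $t\ge0$, $$\mathbf P_{\Pi^{\mathrm{in}}}\{\tau_n>t\}\ge G_n^{\mathrm{in}}e^{-J_nt},$$ where $$G_n^{\mathrm{in}}=\mathbf E_{\Pi^{\mathrm{in}}}\left[\prod_{i=1}^n\Big(\frac{f_i^n}{Q_iz^i}\Big)^{C_i}\right]\ge1-\sum_{i=2}^n\mathbf E_{\Pi^{\mathrm{in}}}[C_i]\Big(1-\frac{f_i^n}{Q_iz^i}\Big).$$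
   Context: $\mathbb N_0=\{0,1,2,\ldots\}$, $\mathbb N_2=\{2,3,\ldots\}$. $\mathcal E=\ell^1(\mathbb N_2,\mathbb N_0)$ is the countable set of summable (hence finitely supported) $\mathbb N_0$-valued sequences $C=(C_2,C_3,\ldots)$, and $\mathcal E_n=\{C\in\mathcal E:C_i=0\text{ for all }i\ge n+1\}$. For a function $h$ on $\mathcal E$, $\mathbf E_\Pi[h(C)]=\sum_Ch(C)\Pi(C)$. Becker–Döring (BD) process: the continuous-time Markov chain $\mathbf C(t)=(C_2(t),C_3(t),\ldots)$ on $\mathcal E$ with generator $$\mathcal A\psi(C)=\sum_{i=1}^\infty\Big(a_izC_i[\psi(C+\Delta_i)-\psi(C)]+b_{i+1}C_{i+1}[\psi(C-\Delta_i)-\psi(C)]\Big),$$ with the convention $C_1=z$, and $\Delta_1=\mathbf e_2$, $\Delta_i=\mathbf e_{i+1}-\mathbf e_i$ for $i\ge2$, where $\mathbf e_2,\mathbf e_3,\ldots$ is the canonical basis. It is non-explosive under the divergence condition in the claim. $\mathbf P_\Pi$ denotes its law when $\mathbf C(0)\sim\Pi$. The exit time is $\tau_n=\inf\{t\ge0:\mathbf C(t)\notin\mathcal E_n\}$. Constants: $$J_n=\Big(\sum_{k=1}^n\frac1{a_kQ_kz^{k+1}}\Big)^{-1},\qquad f_i^n=J_nQ_iz^i\sum_{k=i}^n\frac1{a_kQ_kz^{k+1}}\quad(1\le i\le n),$$ so that $f_1^n=z$ and, with the convention $C_1=z$, the factor $i=1$ in the product defining $G_n^{\mathrm{in}}$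 equals $1$. *)

theory Defs
  imports "HOL-Probability.Probability"
begin

section \<open>Continuous-time Markov chains on a countable state space\<close>

text \<open>The transition rates are read off the generator \<open>L\<close>, an operator on functions on the
  state space: \<open>q(x,y) = (L 1\<^sub>y)(x)\<close> for \<open>y \<noteq> x\<close>, and \<open>q(x) = - (L 1\<^sub>x)(x)\<close> is the total rate
  of leaving \<open>x\<close>.\<close>

definition exit_rate :: "(('s \<Rightarrow> real) \<Rightarrow> 's \<Rightarrow> real) \<Rightarrow> 's \<Rightarrow> real" where
  "exit_rate L x = - L (indicator {x}) x"

definition jump_prob :: "(('s \<Rightarrow> real) \<Rightarrow> 's \<Rightarrow> real) \<Rightarrow> 's \<Rightarrow> 's \<Rightarrow> real" where
  "jump_prob L x y =
     (if exit_rate L x = 0 then (if y = x then 1 else 0)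
      else if y = x then 0
      else L (indicator {y}) x / exit_rate L x)"

text \<open>\<open>markov_chain M S L \<mu> X\<close>: on the probability space \<open>M\<close>, the process \<open>X\<close> is the (minimal)
  continuous-time Markov chain on the countable set \<open>S\<close> with generator \<open>L\<close> and initial law \<open>\<mu>\<close>.
  The definition is the one by jump chain \<open>Y\<close> and holding times \<open>H\<close>: \<open>Y\<close> is a discrete-time
  Markov chain with initial law \<open>\<mu>\<close> and transition matrix \<open>jump_prob L\<close>, and given \<open>Y\<close> the \<open>H\<^sub>j\<close>
  are independent and exponential with rates \<open>exit_rate L (Y\<^sub>j)\<close> (infinite at an absorbing state).
  The value \<open>None\<close> is the cemetery, entered at the explosion time \<open>\<Sum>\<^sub>j H\<^sub>j\<close> if that is finite;
  non-explosion is not part of the definition.\<close>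

definition markov_chain ::
  "'w measure \<Rightarrow> 's set \<Rightarrow> (('s \<Rightarrow> real) \<Rightarrow> 's \<Rightarrow> real) \<Rightarrow> 's pmf \<Rightarrow> (real \<Rightarrow> 'w \<Rightarrow> 's option) \<Rightarrow> bool"
where
  "markov_chain M S L \<mu> X \<longleftrightarrow>
     prob_space M \<and>
     (\<exists>(Y :: nat \<Rightarrow> 'w \<Rightarrow> 's) (H :: nat \<Rightarrow> 'w \<Rightarrow> ennreal).
        (\<forall>k. Y k \<in> measurable M (count_space S)) \<and>
        (\<forall>k. H k \<in> borel_measurable M) \<and>
        (\<forall>k y s. (\<forall>j\<le>k. y j \<in> S \<and> 0 \<le> s j) \<longrightarrow>
           measure M {\<omega> \<in> space M. \<forall>j\<le>k. Y j \<omega> = y j \<and> ennreal (s j) < H j \<omega>}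
           = pmf \<mu> (y 0) * (\<Prod>j<k. jump_prob L (y j) (y (Suc j)))
             * (\<Prod>j\<le>k. exp (- exit_rate L (y j) * s j))) \<and>
        (\<forall>\<omega>\<in>space M. \<forall>t\<ge>0.
           (\<forall>k. (\<Sum>j<k. H j \<omega>) \<le> ennreal t \<and> ennreal t < (\<Sum>j<Suc k. H j \<omega>)
              \<longrightarrow> X t \<omega> = Some (Y k \<omega>)) \<and>
           ((\<forall>k. (\<Sum>j<k. H j \<omega>) \<le> ennreal t) \<longrightarrow> X t \<omega> = None)))"

definition exit_time :: "'s set \<Rightarrow> (real \<Rightarrow> 'w \<Rightarrow> 's option) \<Rightarrow> 'w \<Rightarrow> ereal" where
  "exit_time A X \<omega> = (INF t\<in>{t. 0 \<le> t \<and> X t \<omega> \<notin> Some ` A}. ereal t)"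


section \<open>The Becker--Doering process\<close>

text \<open>A sequence \<open>(C\<^sub>2, C\<^sub>3, \<dots>)\<close> is a function on all of \<open>nat\<close> that vanishes at 0 and 1.\<close>

definition BD_states :: "(nat \<Rightarrow> nat) set" where
  "BD_states = {C. C 0 = 0 \<and> C 1 = 0 \<and> summable (\<lambda>i. real (C i))}"

definition BD_states_upto :: "nat \<Rightarrow> (nat \<Rightarrow> nat) set" where
  "BD_states_upto n = {C \<in> BD_states. \<forall>i\<ge>n + 1. C i = 0}"

text \<open>The convention \<open>C\<^sub>1 = z\<close>.\<close>

definition BD_conc :: "real \<Rightarrow> (nat \<Rightarrow> nat) \<Rightarrow> nat \<Rightarrow> real" where
  "BD_conc z C i = (if i = 1 then z else real (C i))"

definition unit_seq :: "nat \<Rightarrow> nat \<Rightarrow> int" where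
  "unit_seq i j = (if j = i then 1 else 0)"

definition BD_Delta :: "nat \<Rightarrow> nat \<Rightarrow> int" where
  "BD_Delta i j = (if i = 1 then unit_seq 2 j else unit_seq (i + 1) j - unit_seq i j)"

text \<open>The sum \<open>C + v\<close>. Truncation at 0 only affects terms of the generator whose rate is 0.\<close>

definition BD_add :: "(nat \<Rightarrow> nat) \<Rightarrow> (nat \<Rightarrow> int) \<Rightarrow> nat \<Rightarrow> nat" where
  "BD_add C v j = nat (int (C j) + v j)"

definition BD_generator ::
  "(nat \<Rightarrow> real) \<Rightarrow> (nat \<Rightarrow> real) \<Rightarrow> real \<Rightarrow> ((nat \<Rightarrow> nat) \<Rightarrow> real) \<Rightarrow> (nat \<Rightarrow> nat) \<Rightarrow> real"
where
  "BD_generator a b z \<psi> C =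
     (\<Sum>\<^sub>\<infinity>i\<in>{1..}.
        a i * z * BD_conc z C i * (\<psi> (BD_add C (BD_Delta i)) - \<psi> C)
        + b (i + 1) * BD_conc z C (i + 1) * (\<psi> (BD_add C (\<lambda>j. - BD_Delta i j)) - \<psi> C))"

definition BD_Q :: "(nat \<Rightarrow> real) \<Rightarrow> (nat \<Rightarrow> real) \<Rightarrow> nat \<Rightarrow> real" where
  "BD_Q a b i = (\<Prod>j=1..<i. a j) / (\<Prod>j=2..i. b j)"

definition BD_J :: "(nat \<Rightarrow> real) \<Rightarrow> (nat \<Rightarrow> real) \<Rightarrow> real \<Rightarrow> nat \<Rightarrow> real" where
  "BD_J a b z n = inverse (\<Sum>k=1..n. 1 / (a k * BD_Q a b k * z ^ (k + 1)))"

definition BD_f :: "(nat \<Rightarrow> real) \<Rightarrow> (nat \<Rightarrow> real) \<Rightarrow> real \<Rightarrow> nat \<Rightarrow> nat \<Rightarrow> real" where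
  "BD_f a b z n i =
     BD_J a b z n * BD_Q a b i * z ^ i * (\<Sum>k=i..n. 1 / (a k * BD_Q a b k * z ^ (k + 1)))"

text \<open>The exponent is real because \<open>C\<^sub>1 = z\<close>; all bases are positive, so \<open>powr\<close> agrees with the
  usual power for \<open>i \<ge> 2\<close> (including exponent 0).\<close>

definition BD_G ::
  "(nat \<Rightarrow> real) \<Rightarrow> (nat \<Rightarrow> real) \<Rightarrow> real \<Rightarrow> nat \<Rightarrow> (nat \<Rightarrow> nat) pmf \<Rightarrow> real"
where
  "BD_G a b z n \<mu> =
     measure_pmf.expectation \<mu>
       (\<lambda>C. \<Prod>i=1..n. (BD_f a b z n i / (BD_Q a b i * z ^ i)) powr BD_conc z C i)"

end

theory Submission
  imports Defs
begin

text \<open>Write \<open>E\<close> for the set of states without clusters larger than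
  \<open>n\<close>, \<open>L\<close> for the generator and \<open>g i = f i / (Q i z^i)\<close>, so
  that \<open>g 1 = 1\<close> and \<open>g\<close> vanishes at \<open>n + 1\<close>. The proof rests
  on the function \<open>\<psi>(C) = \<Prod>i. g i ^ C i\<close> on \<open>E\<close>, which is an
  eigenfunction of the chain killed on leaving \<open>E\<close>:
  \<open>L \<psi> = - J \<psi>\<close>. Indeed \<open>g\<close> has differences
  \<open>g i - g (i+1) = J / (a i Q i z^(i+1))\<close>, and since
  \<open>b (i+1) Q (i+1) = a i Q i\<close>, the loss that a cluster of size \<open>i \<ge> 2\<close>
  causes by growing cancels the gain that it causes by shrinking. What is left is the creation of a
  cluster of size 2 out of the reservoir, which contributes \<open>- J\<close>; leaving
  \<open>E\<close> through size \<open>n + 1\<close> is accounted for by \<open>g\<close> being 0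
  there. Hence \<open>\<psi>(C(t))\<close> on the event \<open>\<tau> > t\<close> has expectation
  \<open>exp (- J t)\<close> times the expectation of \<open>\<psi>(C(0))\<close>, and
  \<open>\<psi> \<le> 1\<close> turns this into \<open>P(\<tau> > t) \<ge> G exp (- J t)\<close>.
  The lower bound on \<open>G\<close> is a product form of Bernoulli's inequality.\<close>

text \<open>The chain is given by its jump chain and its holding times, so the martingale argument
  is carried out jump by jump. On the event that the jump chain follows a path
  \<open>y 0, \<dots>, y k\<close>, the holding times are independent and exponential, so the time
  \<open>T k\<close> of the \<open>k\<close>-th jump is a sum of independent exponential variables.
  Let \<open>D k\<close> be the expectation of \<open>exp (- J (t - T))\<close> with
  \<open>T = T k\<close> on the event \<open>T k \<le> t\<close>. With \<open>q\<close> the exit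
  rate of \<open>y k\<close>, lemma \<open>discount_exp_step\<close> says \<open>D k = P(T k \<le> t
  < T (k+1)) + (1 - J/q) D (k+1)\<close>. As \<open>(1 - J/q) \<psi>(y k)\<close> is the mean of
  \<open>\<psi>\<close> over the next state, the quantity \<open>\<psi>(y k) D k\<close> is pushed
  one jump ahead at the price of the probability of sitting in \<open>y k\<close> at time
  \<open>t\<close>, which is part of the survival probability
  (\<open>survival_induct\<close>).\<close>

text \<open>The part that remains after \<open>m\<close> jumps tends to 0, because the chain does
  not explode inside \<open>E\<close>: in a state with \<open>l\<close> clusters the exit rate is at
  most \<open>K (1 + l)\<close>, and one jump creates at most one cluster. By the Laplace transform
  of \<open>T m\<close>, for a start with \<open>N\<close> clusters the probability of
  \<open>m\<close> jumps inside \<open>E\<close> before time \<open>t\<close> is at most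
  \<open>exp (K t)\<close> times the telescoping product
  \<open>(1 + N) / (1 + N + m)\<close>.\<close>

section \<open>Sums of independent exponential variables\<close>

text \<open>The tail events \<open>{R\<^sub>i > c}\<close> form an intersection-stable generator of
  the \<open>\<sigma>\<close>-algebra of \<open>R\<^sub>i\<close>, so it suffices to factorise joint
  tails. Thresholds below 0, and indices missing from a subfamily, are handled by the threshold 0,
  since all \<open>R\<^sub>i\<close> are almost surely positive.\<close>

lemma (in prob_space) indep_exponential_of_joint_tails:
  fixes R :: "'i \<Rightarrow> 'a \<Rightarrow> real" and q :: "'i \<Rightarrow> real"
  assumes fin: "finite I"
    and meas: "\<And>i. i \<in> I \<Longrightarrow> R i \<in> borel_measurable M"
    and pos: "\<And>i. i \<in> I \<Longrightarrow> 0 < q i"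
    and tails: "\<And>s. (\<And>i. i \<in> I \<Longrightarrow> 0 \<le> s i) \<Longrightarrow>
       prob {\<omega> \<in> space M. \<forall>i\<in>I. s i < R i \<omega>} = (\<Prod>i\<in>I. exp (- q i * s i))"
  shows "indep_vars (\<lambda>_. borel) R I"
    and "\<And>i. i \<in> I \<Longrightarrow> distributed M lborel (R i) (exponential_density (q i))"
proof -
  note [measurable] = meas
  define tl where "tl i c = exp (- q i * max 0 c)" for i c
  have ev: "{\<omega> \<in> space M. \<forall>i\<in>J. c i < R i \<omega>} \<in> events" if "J \<subseteq> I" for J c
  proof -
    have "finite J" using that fin by (rule finite_subset)
    moreover have "{\<omega> \<in> space M. c i < R i \<omega>} \<in> events" if "i \<in> J" for i
      using meas[of i] \<open>J \<subseteq> I\<close> that by (auto intro!: borel_measurable_less)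
    ultimately show ?thesis by (intro sets.sets_Collect_finite_All) auto
  qed
  have pos_ae: "AE \<omega> in M. \<forall>i\<in>I. 0 < R i \<omega>"
  proof -
    have "prob {\<omega> \<in> space M. \<forall>i\<in>I. 0 < R i \<omega>} = 1"
      using tails[of "\<lambda>_. 0"] by simp
    from AE_prob_1[OF this] show ?thesis by simp
  qed
  have joint: "prob {\<omega> \<in> space M. \<forall>i\<in>J. c i < R i \<omega>} = (\<Prod>i\<in>J. tl i (c i))" if J: "J \<subseteq> I" for J c
  proof -
    define s where "s i = (if i \<in> J then max 0 (c i) else 0)" for i
    have "prob {\<omega> \<in> space M. \<forall>i\<in>J. c i < R i \<omega>} = prob {\<omega> \<in> space M. \<forall>i\<in>I. s i < R i \<omega>}"
    proof (rule finite_measure_eq_AE)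
      show "AE \<omega> in M. (\<omega> \<in> {\<omega> \<in> space M. \<forall>i\<in>J. c i < R i \<omega>}) = (\<omega> \<in> {\<omega> \<in> space M. \<forall>i\<in>I. s i < R i \<omega>})"
        using pos_ae
      proof eventually_elim
        case (elim \<omega>)
        then show ?case using J by (auto simp: s_def subset_eq)
      qed
    qed (use ev J in auto)
    also have "\<dots> = (\<Prod>i\<in>I. exp (- q i * s i))"
      by (rule tails) (auto simp: s_def)
    also have "\<dots> = (\<Prod>i\<in>J. exp (- q i * s i))"
      by (rule prod.mono_neutral_right) (use fin J in \<open>auto simp: s_def\<close>)
    also have "\<dots> = (\<Prod>i\<in>J. tl i (c i))"
      by (intro prod.cong) (auto simp: s_def tl_def)
    finally show ?thesis .
  qed
  have single: "prob {\<omega> \<in> space M. c < R i \<omega>} = tl i c" if "i \<in> I" for i c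
    using joint[of "{i}" "\<lambda>_. c"] that by simp
  show "distributed M lborel (R i) (exponential_density (q i))" if i: "i \<in> I" for i
  proof (subst exponential_distributed_iff[OF pos[OF i]], intro conjI allI impI)
    show "R i \<in> borel_measurable M" using i by simp
    fix c :: real assume c: "0 \<le> c"
    have e: "{\<omega> \<in> space M. c < R i \<omega>} \<in> events" using ev[of "{i}" "\<lambda>_. c"] i by simp
    have "prob {\<omega> \<in> space M. R i \<omega> \<le> c} = prob (space M - {\<omega> \<in> space M. c < R i \<omega>})"
      by (intro arg_cong[where f=prob]) auto
    also have "\<dots> = 1 - exp (- c * q i)"
      using prob_compl[OF e] single[OF i, of c] c by (simp add: tl_def mult.commute)
    finally show "prob {\<omega> \<in> space M. R i \<omega> \<le> c} = 1 - exp (- c * q i)" .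
  qed
  define F where "F i = {R i -` {c<..} \<inter> space M | c. True}" for i
  have F_eq: "R i -` {c<..} \<inter> space M = {\<omega> \<in> space M. c < R i \<omega>}" for i c by auto
  have "indep_sets F I"
  proof (rule indep_setsI)
    show "F i \<subseteq> events" if "i \<in> I" for i
      using ev[of "{i}"] that by (auto simp: F_def F_eq)
    fix A J assume J: "J \<noteq> {}" "J \<subseteq> I" "finite J" "\<forall>j\<in>J. A j \<in> F j"
    then obtain c where c: "\<And>j. j \<in> J \<Longrightarrow> A j = {\<omega> \<in> space M. c j < R j \<omega>}"
      unfolding F_def F_eq by simp metis
    have "(\<Inter>j\<in>J. A j) = {\<omega> \<in> space M. \<forall>j\<in>J. c j < R j \<omega>}"
      using c J(1) by auto
    then have "prob (\<Inter>j\<in>J. A j) = (\<Prod>j\<in>J. tl j (c j))" using joint[OF J(2)] by simp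
    also have "\<dots> = (\<Prod>j\<in>J. prob (A j))"
      using single c J(2) by (intro prod.cong) auto
    finally show "prob (\<Inter>j\<in>J. A j) = (\<Prod>j\<in>J. prob (A j))" .
  qed
  then have "indep_sets (\<lambda>i. sigma_sets (space M) (F i)) I"
  proof (rule indep_sets_sigma)
    show "Int_stable (F i)" for i
    proof (rule Int_stableI)
      fix a b assume "a \<in> F i" "b \<in> F i"
      then obtain c d where "a = R i -` {c<..} \<inter> space M" "b = R i -` {d<..} \<inter> space M"
        by (auto simp: F_def)
      then have "a \<inter> b = R i -` {max c d<..} \<inter> space M" by auto
      then show "a \<inter> b \<in> F i" by (auto simp: F_def)
    qed
  qed
  moreover have "sigma_sets (space M) {R i -` A \<inter> space M |A. A \<in> sets borel} = sigma_sets (space M) (F i)" for i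
  proof -
    have b: "sets borel = sigma_sets UNIV (range (\<lambda>c::real. {c<..}))"
      by (subst borel_Ioi) (simp add: sets_measure_of)
    have "{R i -` A \<inter> space M |A. A \<in> sets borel} = sigma_sets (space M) {R i -` A \<inter> space M |A. A \<in> range (\<lambda>c::real. {c<..})}"
      unfolding b by (rule sigma_sets_vimage_commute) auto
    also have "{R i -` A \<inter> space M |A. A \<in> range (\<lambda>c::real. {c<..})} = F i"
      by (auto simp: F_def)
    finally have eq: "{R i -` A \<inter> space M |A. A \<in> sets borel} = sigma_sets (space M) (F i)" .
    show ?thesis unfolding eq
      by (intro sigma_sets_sigma_sets_eq) (auto simp: F_def)
  qed
  ultimately show "indep_vars (\<lambda>_. borel) R I"
    unfolding indep_vars_def using meas by simp
qed

text \<open>The law of a sum of \<open>k\<close> independent exponential variables with rates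
  \<open>q 0, \<dots>, q (k - 1)\<close>. Having it as a measure of its own lets laws of jump times
  be compared between different path events.\<close>

primrec exp_sum :: "(nat \<Rightarrow> real) \<Rightarrow> nat \<Rightarrow> real measure" where
  "exp_sum q 0 = return borel 0"
| "exp_sum q (Suc k) = convolution (exp_sum q k) (density lborel (exponential_density (q k)))"

lemma exp_sum_cong: "(\<And>j. j < k \<Longrightarrow> q j = q' j) \<Longrightarrow> exp_sum q k = exp_sum q' k"
  by (induction k) auto

lemma sets_exp_sum [simp, measurable_cong]: "sets (exp_sum q k) = sets borel"
  by (cases k) auto

lemma prob_space_exp_sum:
  "(\<And>j. j < k \<Longrightarrow> 0 < q j) \<Longrightarrow> prob_space (exp_sum q k)"
proof (induction k)
  case 0 then show ?case by (simp add: prob_space_return)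
next
  case (Suc k)
  interpret N: prob_space "exp_sum q k" using Suc by simp
  interpret D: prob_space "density lborel (exponential_density (q k))"
    using Suc.prems by (intro prob_space_exponential_density) simp
  interpret ND: pair_prob_space "exp_sum q k" "density lborel (exponential_density (q k))" ..
  show ?case unfolding exp_sum.simps convolution_def
    by (rule ND.prob_space_distr) measurable
qed

lemma (in prob_space) distr_partial_sum_exponential:
  fixes R :: "nat \<Rightarrow> 'a \<Rightarrow> real"
  assumes ind: "indep_vars (\<lambda>_. borel) R {..<n}"
    and dist: "\<And>j. j < n \<Longrightarrow> distributed M lborel (R j) (exponential_density (q j))"
    and k: "k \<le> n"
  shows "distr M borel (\<lambda>\<omega>. \<Sum>j<k. R j \<omega>) = exp_sum q k"
  using k
proof (induction k)
  case 0
  show ?case by (simp add: distr_const)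
next
  case (Suc k)
  have rv: "R j \<in> borel_measurable M" if "j < n" for j
    using distributed_measurable[OF dist[OF that]] by simp
  have iv: "indep_var borel (R k) borel (\<lambda>\<omega>. \<Sum>j<k. R j \<omega>)"
    by (rule indep_vars_sum) (use Suc.prems in \<open>auto intro: indep_vars_subset[OF ind]\<close>)
  have sum_rv: "(\<lambda>\<omega>. \<Sum>j<k. R j \<omega>) \<in> borel_measurable M"
    using rv Suc.prems by (intro borel_measurable_sum) auto
  have "distr M borel (R k) = distr M lborel (R k)" by (rule distr_cong) auto
  then have Rk: "distr M borel (R k) = density lborel (exponential_density (q k))"
    using distributed_distr_eq_density[OF dist[of k]] Suc.prems by simp
  have fm: "finite_measure (distr M borel (\<lambda>\<omega>. \<Sum>j<k. R j \<omega>))" "finite_measure (distr M borel (R k))"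
    using sum_rv rv[of k] Suc.prems by (auto intro!: finite_measure_distr)
  have "distr M borel (\<lambda>\<omega>. \<Sum>j<Suc k. R j \<omega>) = distr M borel (\<lambda>\<omega>. R k \<omega> + (\<Sum>j<k. R j \<omega>))"
    by (simp add: add.commute)
  also have "\<dots> = convolution (distr M borel (R k)) (distr M borel (\<lambda>\<omega>. \<Sum>j<k. R j \<omega>))"
    by (rule sum_indep_random_variable[OF iv]) (use sum_rv rv[of k] Suc.prems in auto)
  also have "\<dots> = convolution (distr M borel (\<lambda>\<omega>. \<Sum>j<k. R j \<omega>)) (distr M borel (R k))"
    by (rule convolution_commutative) (use fm in auto)
  also have "\<dots> = exp_sum q (Suc k)" using Suc Rk by simp
  finally show ?case .
qed

text \<open>Markov's inequality for \<open>exp (- \<theta> \<sigma>)\<close>, whose mean is a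
  product over the summands. This is the only estimate behind the absence of explosion.\<close>

lemma exp_sum_atMost_le:
  assumes "0 < \<theta>" "\<And>j. j < k \<Longrightarrow> 0 < q j"
  shows "measure (exp_sum q k) {..t} \<le> exp (\<theta> * t) * (\<Prod>j<k. q j / (q j + \<theta>))"
proof -
  have laplace: "(\<integral>\<^sup>+\<sigma>. ennreal (exp (- \<theta> * \<sigma>)) \<partial>exp_sum q k) = ennreal (\<Prod>j<k. q j / (q j + \<theta>))"
    using assms(2)
  proof (induction k)
    case 0
    show ?case by (simp add: nn_integral_return)
  next
    case (Suc k)
    let ?E = "density lborel (exponential_density (q k))"
    have q: "0 < q k" using Suc.prems by simp
    interpret N: prob_space "exp_sum q k" using Suc.prems by (intro prob_space_exp_sum) simp
    interpret D: prob_space ?E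
      using q by (rule prob_space_exponential_density)
    interpret D': prob_space "density lborel (exponential_density (q k + \<theta>))"
      using q assms(1) by (intro prob_space_exponential_density) simp
    have one: "(\<integral>\<^sup>+s. ennreal (exp (- \<theta> * s)) \<partial>?E) = ennreal (q k / (q k + \<theta>))"
    proof -
      have "(\<integral>\<^sup>+s. ennreal (exp (- \<theta> * s)) \<partial>?E)
          = (\<integral>\<^sup>+s. ennreal (exponential_density (q k) s) * ennreal (exp (- \<theta> * s)) \<partial>lborel)"
        by (subst nn_integral_density) auto
      also have "\<dots> = (\<integral>\<^sup>+s. ennreal (q k / (q k + \<theta>)) * ennreal (exponential_density (q k + \<theta>) s) \<partial>lborel)"
        using q assms(1)
        by (intro nn_integral_cong)
           (auto simp: exponential_density_def ennreal_mult'[symmetric] exp_add[symmetric] field_simps)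
      also have "\<dots> = ennreal (q k / (q k + \<theta>)) * (\<integral>\<^sup>+s. ennreal (exponential_density (q k + \<theta>) s) \<partial>lborel)"
        by (rule nn_integral_cmult) auto
      also have "(\<integral>\<^sup>+s. ennreal (exponential_density (q k + \<theta>) s) \<partial>lborel) = 1"
        using D'.emeasure_space_1 by (simp add: emeasure_density)
      finally show ?thesis by simp
    qed
    have "(\<integral>\<^sup>+\<sigma>. ennreal (exp (- \<theta> * \<sigma>)) \<partial>exp_sum q (Suc k))
        = (\<integral>\<^sup>+\<sigma>. \<integral>\<^sup>+s. ennreal (exp (- \<theta> * (\<sigma> + s))) \<partial>?E \<partial>exp_sum q k)"
      unfolding exp_sum.simps
      by (subst nn_integral_convolution) (auto intro: N.finite_measure_axioms D.finite_measure_axioms)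
    also have "\<dots> = (\<integral>\<^sup>+\<sigma>. ennreal (exp (- \<theta> * \<sigma>)) * ennreal (q k / (q k + \<theta>)) \<partial>exp_sum q k)"
    proof (rule nn_integral_cong)
      fix \<sigma>
      have "(\<integral>\<^sup>+s. ennreal (exp (- \<theta> * (\<sigma> + s))) \<partial>?E)
          = (\<integral>\<^sup>+s. ennreal (exp (- \<theta> * \<sigma>)) * ennreal (exp (- \<theta> * s)) \<partial>?E)"
        by (intro nn_integral_cong) (simp add: ennreal_mult'[symmetric] exp_add[symmetric] algebra_simps)
      also have "\<dots> = ennreal (exp (- \<theta> * \<sigma>)) * (\<integral>\<^sup>+s. ennreal (exp (- \<theta> * s)) \<partial>?E)"
        by (rule nn_integral_cmult) auto
      finally show "(\<integral>\<^sup>+s. ennreal (exp (- \<theta> * (\<sigma> + s))) \<partial>?E) = ennreal (exp (- \<theta> * \<sigma>)) * ennreal (q k / (q k + \<theta>))"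
        unfolding one .
    qed
    also have "\<dots> = (\<integral>\<^sup>+\<sigma>. ennreal (exp (- \<theta> * \<sigma>)) \<partial>exp_sum q k) * ennreal (q k / (q k + \<theta>))"
      by (rule nn_integral_multc) auto
    also have "\<dots> = ennreal (\<Prod>j<k. q j / (q j + \<theta>)) * ennreal (q k / (q k + \<theta>))"
      using Suc by simp
    also have "\<dots> = ennreal (\<Prod>j<Suc k. q j / (q j + \<theta>))"
      using q assms(1) by (subst ennreal_mult''[symmetric]) auto
    finally show ?case .
  qed
  interpret N: prob_space "exp_sum q k" using assms by (intro prob_space_exp_sum)
  have "emeasure (exp_sum q k) {..t} = (\<integral>\<^sup>+\<sigma>. indicator {..t} \<sigma> \<partial>exp_sum q k)"
    by simp
  also have "\<dots> \<le> (\<integral>\<^sup>+\<sigma>. ennreal (exp (\<theta> * t)) * ennreal (exp (- \<theta> * \<sigma>)) \<partial>exp_sum q k)"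
    using assms(1)
    by (intro nn_integral_mono)
       (auto simp: indicator_def ennreal_mult'[symmetric] exp_add[symmetric] simp flip: ennreal_1 intro!: ennreal_leI)
  also have "\<dots> = ennreal (exp (\<theta> * t)) * ennreal (\<Prod>j<k. q j / (q j + \<theta>))"
    unfolding laplace[symmetric] by (rule nn_integral_cmult) auto
  also have "\<dots> = ennreal (exp (\<theta> * t) * (\<Prod>j<k. q j / (q j + \<theta>)))"
    by (simp add: ennreal_mult')
  finally show ?thesis
  proof -
    assume le: "emeasure (exp_sum q k) {..t} \<le> ennreal (exp (\<theta> * t) * (\<Prod>j<k. q j / (q j + \<theta>)))"
    have "0 \<le> q j / (q j + \<theta>)" if "j < k" for j
      using assms(1) assms(2)[OF that] by simp
    then have "0 \<le> exp (\<theta> * t) * (\<Prod>j<k. q j / (q j + \<theta>))"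
      by (intro mult_nonneg_nonneg prod_nonneg) auto
    with le show ?thesis by (simp add: N.emeasure_eq_measure)
  qed
qed

text \<open>If a jump at time \<open>\<sigma> \<le> t\<close> leads to \<open>x\<close>, then
  \<open>\<psi> x exp (- J (t - \<sigma>))\<close> is what the eigenfunction predicts for the
  remaining time. This is the mean of that prediction, up to the factor \<open>\<psi> x\<close>,
  when \<open>N\<close> is the law of the jump time.\<close>

definition discount :: "real \<Rightarrow> real \<Rightarrow> real measure \<Rightarrow> real" where
  "discount J t N = (\<integral>\<sigma>. indicator {..t} \<sigma> * exp (- J * (t - \<sigma>)) \<partial>N)"

lemma discount_nonneg: "0 \<le> discount J t N"
  unfolding discount_def by (intro Bochner_Integration.integral_nonneg) simp

lemma discount_bounded_integrable:
  fixes N :: "real measure" and J t :: real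
  assumes "finite_measure N" "sets N = sets borel" "0 \<le> J"
  shows "integrable N (\<lambda>\<sigma>. indicator {..t} \<sigma> * exp (- J * (t - \<sigma>)))"
proof -
  interpret finite_measure N by fact
  note [measurable_cong] = assms(2)
  show ?thesis
  proof (rule integrable_const_bound[where B=1])
    show "AE \<sigma> in N. norm (indicator {..t} \<sigma> * exp (- J * (t - \<sigma>))) \<le> 1"
      using assms(3) by (intro AE_I2) (auto simp: indicator_def)
  qed measurable
qed

lemma discount_le_measure:
  fixes N :: "real measure" and J t :: real
  assumes "finite_measure N" "sets N = sets borel" "0 \<le> J"
  shows "discount J t N \<le> measure N {..t}"
proof -
  interpret finite_measure N by fact
  have sp: "space N = UNIV" using sets_eq_imp_space_eq[OF assms(2)] by simp
  have "discount J t N \<le> (\<integral>\<sigma>. indicator {..t} \<sigma> \<partial>N)"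
    unfolding discount_def using assms
    by (intro integral_mono discount_bounded_integrable integrable_real_indicator)
       (auto simp: indicator_def less_top[symmetric])
  then show ?thesis by (simp add: sp)
qed

text \<open>For a single exponential time \<open>s\<close> with rate \<open>q\<close> and remaining
  time \<open>r \<ge> 0\<close>, the equation \<open>exp (- J r) = P(s > r) + (1 - J/q) E[exp (- J
  (r - s)); s \<le> r]\<close> is the variation of constants formula for \<open>u' = - J u\<close>;
  integrating it over \<open>N\<close> gives the claim. Keeping both terms under one integral avoids
  a division by \<open>q - J\<close>, which may be 0.\<close>

lemma discount_exp_step:
  assumes N: "prob_space N" "sets N = sets borel" and q: "0 < q" and J: "0 \<le> J"
  defines "N' \<equiv> convolution N (density lborel (exponential_density q))"
  shows "(1 - J / q) * discount J t N' - measure N' {..t} = discount J t N - measure N {..t}"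
proof -
  let ?E = "density lborel (exponential_density q)"
  interpret N: prob_space N by fact
  interpret E: prob_space ?E using q by (rule prob_space_exponential_density)
  interpret NE: pair_prob_space N ?E ..
  note [measurable_cong] = N(2)
  have spN: "space N = UNIV" using sets_eq_imp_space_eq[OF N(2)] by simp
  interpret N': prob_space N'
    unfolding N'_def convolution_def by (rule NE.prob_space_distr) measurable
  have sN': "sets N' = sets borel" by (simp add: N'_def)
  have spN': "space N' = UNIV" using sets_eq_imp_space_eq[OF sN'] by simp
  define f where "f \<sigma> = indicator {..t} \<sigma> * ((1 - J / q) * exp (- J * (t - \<sigma>)) - 1)" for \<sigma> :: real
  have [measurable]: "f \<in> borel_measurable borel" unfolding f_def by measurable
  have fb: "\<bar>f \<sigma>\<bar> \<le> \<bar>1 - J / q\<bar> + 1" for \<sigma>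
  proof (cases "\<sigma> \<le> t")
    case True
    have "\<bar>(1 - J / q) * exp (- J * (t - \<sigma>))\<bar> \<le> \<bar>1 - J / q\<bar> * 1"
      unfolding abs_mult using True J by (intro mult_left_mono) auto
    then show ?thesis using True unfolding f_def by simp
  qed (simp add: f_def)
  have inner: "(\<integral>s. f (\<sigma> + s) \<partial>?E) = indicator {..t} \<sigma> * (exp (- J * (t - \<sigma>)) - 1)" for \<sigma>
  proof -
    define r where "r = t - \<sigma>"
    define g where "g s = q * exp (- q * s) * ((1 - J / q) * exp (- J * (r - s)) - 1)" for s
    \<comment> \<open>an antiderivative of \<open>g\<close>\<close>
    define \<Phi> where "\<Phi> s = exp (- q * s) - exp (- J * r - (q - J) * s)" for s
    have "(\<integral>s. f (\<sigma> + s) \<partial>?E) = (\<integral>s. exponential_density q s *\<^sub>R f (\<sigma> + s) \<partial>lborel)"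
      using q by (intro integral_density) (auto intro!: exponential_density_nonneg)
    also have "\<dots> = (\<integral>s. indicator {0..r} s *\<^sub>R g s \<partial>lborel)"
      by (intro Bochner_Integration.integral_cong)
         (auto simp: exponential_density_def f_def g_def r_def indicator_def algebra_simps)
    also have "\<dots> = indicator {..t} \<sigma> * (exp (- J * (t - \<sigma>)) - 1)"
    proof (cases "0 \<le> r")
      case True
      have "has_bochner_integral lborel (\<lambda>s. indicator {0..r} s *\<^sub>R g s) (\<Phi> r - \<Phi> 0)"
      proof (rule has_bochner_integral_FTC_Icc[OF True])
        fix s
        have "(\<Phi> has_real_derivative g s) (at s)"
        proof -
          have e: "exp (- J * r - (q - J) * s) = exp (- q * s) * exp (- J * (r - s))"
            by (simp add: exp_add[symmetric] algebra_simps)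
          have "(\<Phi> has_real_derivative (- q * exp (- q * s) + (q - J) * exp (- J * r - (q - J) * s))) (at s)"
            unfolding \<Phi>_def by (auto intro!: derivative_eq_intros simp: algebra_simps)
          also have "- q * exp (- q * s) + (q - J) * exp (- J * r - (q - J) * s) = g s"
            unfolding e g_def using q by (simp add: field_simps)
          finally show ?thesis .
        qed
        then show "(\<Phi> has_vector_derivative g s) (at s within {0..r})"
          by (simp add: has_real_derivative_iff_has_vector_derivative has_vector_derivative_at_within)
      next
        show "continuous_on {0..r} g" unfolding g_def by (intro continuous_intros)
      qed
      moreover have "\<Phi> r - \<Phi> 0 = exp (- J * r) - 1" by (simp add: \<Phi>_def algebra_simps)
      ultimately show ?thesis using True
        by (simp add: has_bochner_integral_iff r_def)
    next
      case False
      then show ?thesis by (simp add: r_def)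
    qed
    finally show ?thesis .
  qed
  have "(1 - J / q) * discount J t N' - measure N' {..t} = (\<integral>\<sigma>. f \<sigma> \<partial>N')"
  proof -
    have "(\<integral>\<sigma>. f \<sigma> \<partial>N') = (\<integral>\<sigma>. (1 - J / q) * (indicator {..t} \<sigma> * exp (- J * (t - \<sigma>))) - indicator {..t} \<sigma> \<partial>N')"
      by (intro Bochner_Integration.integral_cong) (auto simp: f_def algebra_simps)
    also have "\<dots> = (1 - J / q) * discount J t N' - measure N' {..t}"
      unfolding discount_def
      by (subst Bochner_Integration.integral_diff)
         (auto intro!: Bochner_Integration.integrable_mult_right discount_bounded_integrable[unfolded mult_minus_left] N'.finite_measure_axioms
            sN' J integrable_real_indicator simp: spN' sN' less_top[symmetric])
    finally show ?thesis by simp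
  qed
  also have "(\<integral>\<sigma>. f \<sigma> \<partial>N') = (\<integral>p. f (fst p + snd p) \<partial>(N \<Otimes>\<^sub>M ?E))"
    unfolding N'_def convolution_def
    by (subst integral_distr) (auto simp: case_prod_unfold)
  also have "\<dots> = (\<integral>\<sigma>. (\<integral>s. f (\<sigma> + s) \<partial>?E) \<partial>N)"
    by (subst NE.integral_fst'[symmetric])
       (auto intro!: NE.integrable_const_bound[where B="\<bar>1 - J / q\<bar> + 1"] fb)
  also have "\<dots> = (\<integral>\<sigma>. indicator {..t} \<sigma> * exp (- J * (t - \<sigma>)) - indicator {..t} \<sigma> \<partial>N)"
    unfolding inner by (simp add: algebra_simps)
  also have "\<dots> = discount J t N - measure N {..t}"
    unfolding discount_def
    by (subst Bochner_Integration.integral_diff)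
       (auto intro!: discount_bounded_integrable[unfolded mult_minus_left] N.finite_measure_axioms N(2) J integrable_real_indicator
         simp: spN N(2) less_top[symmetric])
  finally show ?thesis .
qed

section \<open>Chains given by jumps and holding times\<close>

text \<open>The representation behind \<^const>\<open>markov_chain\<close> with the jump chain
  \<open>Y\<close> and the holding times \<open>H\<close> made explicit.\<close>

locale jump_holding_chain = prob_space M
  for M :: "'w measure" +
  fixes S :: "'s set" and L :: "('s \<Rightarrow> real) \<Rightarrow> 's \<Rightarrow> real" and \<mu> :: "'s pmf"
    and X :: "real \<Rightarrow> 'w \<Rightarrow> 's option"
    and Y :: "nat \<Rightarrow> 'w \<Rightarrow> 's" and H :: "nat \<Rightarrow> 'w \<Rightarrow> ennreal"
  assumes Y_measurable: "Y k \<in> measurable M (count_space S)"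
    and H_measurable [measurable]: "H k \<in> borel_measurable M"
    and path_law: "\<And>k y s. (\<And>j. j \<le> k \<Longrightarrow> y j \<in> S \<and> 0 \<le> s j) \<Longrightarrow>
       measure M {\<omega> \<in> space M. \<forall>j\<le>k. Y j \<omega> = y j \<and> ennreal (s j) < H j \<omega>}
       = pmf \<mu> (y 0) * (\<Prod>j<k. jump_prob L (y j) (y (Suc j)))
         * (\<Prod>j\<le>k. exp (- exit_rate L (y j) * s j))"
    and X_between_jumps: "\<And>\<omega> t k. \<omega> \<in> space M \<Longrightarrow> 0 \<le> t \<Longrightarrow> (\<Sum>j<k. H j \<omega>) \<le> ennreal t \<Longrightarrow>
       ennreal t < (\<Sum>j<Suc k. H j \<omega>) \<Longrightarrow> X t \<omega> = Some (Y k \<omega>)"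
    and X_after_explosion: "\<And>\<omega> t. \<omega> \<in> space M \<Longrightarrow> 0 \<le> t \<Longrightarrow> (\<And>k. (\<Sum>j<k. H j \<omega>) \<le> ennreal t) \<Longrightarrow>
       X t \<omega> = None"

lemma markov_chain_jump_holding:
  assumes "markov_chain M S L \<mu> X"
  obtains Y H where "jump_holding_chain M S L \<mu> X Y H"
proof -
  from assms obtain Y :: "nat \<Rightarrow> _ \<Rightarrow> _" and H :: "nat \<Rightarrow> _ \<Rightarrow> ennreal" where *: "prob_space M"
    "\<forall>k. Y k \<in> measurable M (count_space S)"
    "\<forall>k. H k \<in> borel_measurable M"
    "\<forall>k y s. (\<forall>j\<le>k. y j \<in> S \<and> 0 \<le> s j) \<longrightarrow>
       measure M {\<omega> \<in> space M. \<forall>j\<le>k. Y j \<omega> = y j \<and> ennreal (s j) < H j \<omega>}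
       = pmf \<mu> (y 0) * (\<Prod>j<k. jump_prob L (y j) (y (Suc j)))
         * (\<Prod>j\<le>k. exp (- exit_rate L (y j) * s j))"
    "\<forall>\<omega>\<in>space M. \<forall>t\<ge>0.
       (\<forall>k. (\<Sum>j<k. H j \<omega>) \<le> ennreal t \<and> ennreal t < (\<Sum>j<Suc k. H j \<omega>)
          \<longrightarrow> X t \<omega> = Some (Y k \<omega>)) \<and>
       ((\<forall>k. (\<Sum>j<k. H j \<omega>) \<le> ennreal t) \<longrightarrow> X t \<omega> = None)"
    unfolding markov_chain_def by blast
  interpret prob_space M by fact
  have "jump_holding_chain M S L \<mu> X Y H"
  proof (unfold_locales, goal_cases)
    case (3 k y s)
    show ?case by (rule *(4)[rule_format]) (use 3 in auto)
  qed (use *(2,3,5) in auto)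
  then show thesis by (rule that)
qed

context jump_holding_chain
begin

definition jump_time :: "nat \<Rightarrow> 'w \<Rightarrow> ennreal" where
  "jump_time k \<omega> = (\<Sum>j<k. H j \<omega>)"

lemma jump_time_measurable [measurable]: "jump_time k \<in> borel_measurable M"
  unfolding jump_time_def by measurable

lemma jump_time_0 [simp]: "jump_time 0 \<omega> = 0"
  by (simp add: jump_time_def)

lemma jump_time_Suc: "jump_time (Suc k) \<omega> = jump_time k \<omega> + H k \<omega>"
  by (simp add: jump_time_def)

lemma jump_time_mono: "i \<le> j \<Longrightarrow> jump_time i \<omega> \<le> jump_time j \<omega>"
  unfolding jump_time_def by (rule sum_mono2) auto

lemma last_jump_before:
  obtains k where "jump_time k \<omega> \<le> t" "t < jump_time (Suc k) \<omega>"
  | "\<And>k. jump_time k \<omega> \<le> t"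
proof (cases "\<forall>k. jump_time k \<omega> \<le> t")
  case False
  then obtain m where "\<not> jump_time m \<omega> \<le> t" by blast
  then obtain k where k: "k < m" "\<forall>i\<le>k. \<not> \<not> jump_time i \<omega> \<le> t" "\<not> jump_time (Suc k) \<omega> \<le> t"
    using ex_least_nat_less[of "\<lambda>k. \<not> jump_time k \<omega> \<le> t" m] by auto
  show ?thesis by (rule that(1)[of k]) (use k in auto)
qed (use that(2) in auto)

text \<open>Paths are right-continuous steps, so survival up to time \<open>t\<close> means that
  only finitely many jumps occur by then and that the states seen lie in \<open>A\<close>. States
  with holding time 0 are never seen by \<open>X\<close>. In the direction from right to left the
  path stays in \<open>A\<close> until the next jump, which is strictly after \<open>t\<close>; this
  gives the strict inequality.\<close>

lemma exit_time_gt_iff: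
  assumes \<omega>: "\<omega> \<in> space M" and t: "0 \<le> t"
  shows "ereal t < exit_time A X \<omega> \<longleftrightarrow>
    (\<exists>k. jump_time k \<omega> \<le> ennreal t \<and> ennreal t < jump_time (Suc k) \<omega> \<and>
       (\<forall>j\<le>k. H j \<omega> = 0 \<or> Y j \<omega> \<in> A))"
proof
  assume gt: "ereal t < exit_time A X \<omega>"
  have in_A: "X s \<omega> \<in> Some ` A" if "0 \<le> s" "s \<le> t" for s
  proof (rule ccontr)
    assume "X s \<omega> \<notin> Some ` A"
    then have "exit_time A X \<omega> \<le> ereal s"
      unfolding exit_time_def using that by (intro INF_lower) auto
    also have "ereal s \<le> ereal t" using that by simp
    finally show False using gt by simp
  qed
  show "\<exists>k. jump_time k \<omega> \<le> ennreal t \<and> ennreal t < jump_time (Suc k) \<omega> \<and>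
       (\<forall>j\<le>k. H j \<omega> = 0 \<or> Y j \<omega> \<in> A)"
  proof (cases rule: last_jump_before[of \<omega> "ennreal t"])
    case (1 k)
    have stay: "Y j \<omega> \<in> A" if j: "j \<le> k" "H j \<omega> \<noteq> 0" for j
    proof -
      have le: "jump_time j \<omega> \<le> ennreal t"
        using order_trans[OF jump_time_mono[OF j(1)] 1(1)] .
      have fin: "jump_time j \<omega> < top" using le_less_trans[OF le ennreal_less_top] .
      define s where "s = enn2real (jump_time j \<omega>)"
      have s: "ennreal s = jump_time j \<omega>" "0 \<le> s" using fin by (auto simp: s_def)
      have "s \<le> t" using le t unfolding s(1)[symmetric] by (subst (asm) ennreal_le_iff) auto
      have "jump_time j \<omega> < jump_time (Suc j) \<omega>"
      proof -
        have "jump_time j \<omega> + 0 < jump_time j \<omega> + H j \<omega>"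
          unfolding ennreal_add_left_cancel_less using fin j(2) by (simp add: zero_less_iff_neq_zero)
        then show ?thesis by (simp add: jump_time_Suc)
      qed
      then have "X s \<omega> = Some (Y j \<omega>)"
        using s \<omega> unfolding jump_time_def by (intro X_between_jumps) simp_all
      then show ?thesis using in_A[of s] s(2) \<open>s \<le> t\<close> by auto
    qed
    show ?thesis using 1 stay by (intro exI[of _ k]) auto
  next
    case 2
    then have "X t \<omega> = None" using \<omega> t unfolding jump_time_def by (intro X_after_explosion)
    then show ?thesis using in_A[of t] t by auto
  qed
next
  assume "\<exists>k. jump_time k \<omega> \<le> ennreal t \<and> ennreal t < jump_time (Suc k) \<omega> \<and>
       (\<forall>j\<le>k. H j \<omega> = 0 \<or> Y j \<omega> \<in> A)"
  then obtain k where k: "ennreal t < jump_time (Suc k) \<omega>" "\<forall>j\<le>k. H j \<omega> = 0 \<or> Y j \<omega> \<in> A"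
    by (elim exE conjE)
  obtain c where c: "ennreal t < c" "c < jump_time (Suc k) \<omega>" using dense[OF k(1)] by (elim exE conjE)
  have "c < top" using less_le_trans[OF c(2) top_greatest] .
  then obtain u where u: "c = ennreal u" "0 \<le> u" by (cases c) auto
  have "t < u" using c(1) t unfolding u(1) by (subst (asm) ennreal_less_iff) auto
  have "ereal u \<le> exit_time A X \<omega>"
    unfolding exit_time_def
  proof (rule INF_greatest)
    fix s assume "s \<in> {s. 0 \<le> s \<and> X s \<omega> \<notin> Some ` A}"
    then have s: "0 \<le> s" "X s \<omega> \<notin> Some ` A" by auto
    show "ereal u \<le> ereal s"
    proof (rule ccontr)
      assume "\<not> ereal u \<le> ereal s"
      then have "ennreal s < c" using u s by (simp add: ennreal_less_iff)
      then have lt: "ennreal s < jump_time (Suc k) \<omega>" using c(2) by (rule order_less_trans)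
      show False
      proof (cases rule: last_jump_before[of \<omega> "ennreal s"])
        case (1 j)
        have jk: "j \<le> k"
        proof (rule ccontr)
          assume "\<not> j \<le> k"
          then have "jump_time (Suc k) \<omega> \<le> jump_time j \<omega>" by (intro jump_time_mono) simp
          also have "\<dots> \<le> ennreal s" by (rule 1)
          finally show False using lt by simp
        qed
        have "H j \<omega> \<noteq> 0"
        proof
          assume "H j \<omega> = 0"
          then have "jump_time (Suc j) \<omega> = jump_time j \<omega>" by (simp add: jump_time_Suc)
          then show False using 1 by simp
        qed
        then have "Y j \<omega> \<in> A" using k(2)[rule_format, OF \<open>j \<le> k\<close>] by simp
        moreover have "X s \<omega> = Some (Y j \<omega>)"
          using 1 \<omega> s(1) unfolding jump_time_def by (intro X_between_jumps)
        ultimately show False using s by auto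
      next
        case 2
        have "jump_time (Suc k) \<omega> \<le> ennreal s" by (rule 2)
        then show False using lt by simp
      qed
    qed
  qed
  then show "ereal t < exit_time A X \<omega>" using \<open>t < u\<close> by (simp add: less_le_trans[of "ereal t" "ereal u"])
qed

lemma Y_in_event:
  assumes "A \<subseteq> S"
  shows "{\<omega> \<in> space M. Y j \<omega> \<in> A} \<in> events"
proof -
  have "{\<omega> \<in> space M. Y j \<omega> \<in> A} = Y j -` A \<inter> space M" by blast
  then show ?thesis using measurable_sets[OF Y_measurable, of A j] assms by simp
qed

text \<open>The exit time is an infimum over uncountably many times; its measurability comes from
  the countable description in terms of jumps.\<close>

lemma exit_time_gt_event:
  assumes A: "A \<subseteq> S" and t: "0 \<le> t"
  shows "{\<omega> \<in> space M. ereal t < exit_time A X \<omega>} \<in> events"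
proof -
  have "{\<omega> \<in> space M. ereal t < exit_time A X \<omega>} =
    {\<omega> \<in> space M. \<exists>k. jump_time k \<omega> \<le> ennreal t \<and> ennreal t < jump_time (Suc k) \<omega> \<and>
       (\<forall>j\<le>k. H j \<omega> = 0 \<or> Y j \<omega> \<in> A)}"
    using exit_time_gt_iff[OF _ t] by auto
  also have "\<dots> \<in> events"
  proof -
    have [measurable]: "Measurable.pred M (\<lambda>\<omega>. Y j \<omega> \<in> A)" for j
      using Y_in_event[OF A] by (simp add: pred_def)
    show ?thesis by measurable
  qed
  finally show ?thesis .
qed

definition path_prob :: "nat \<Rightarrow> (nat \<Rightarrow> 's) \<Rightarrow> real" where
  "path_prob k y = pmf \<mu> (y 0) * (\<Prod>j<k. jump_prob L (y j) (y (Suc j)))"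

text \<open>The degenerate holding times 0 and \<open>\<infinity>\<close> are excluded here, so that
  these events behave well under extension of the path and the holding times become real-valued on
  them. No probability is lost, see \<open>prob_path_event\<close>.\<close>

definition path_event :: "nat \<Rightarrow> (nat \<Rightarrow> 's) \<Rightarrow> 'w set" where
  "path_event k y = {\<omega> \<in> space M. \<forall>j\<le>k. Y j \<omega> = y j \<and> 0 < H j \<omega> \<and> H j \<omega> < top}"

lemma Y_eq_event:
  assumes "x \<in> S"
  shows "{\<omega> \<in> space M. Y j \<omega> = x} \<in> events"
  using Y_in_event[of "{x}" j] assms by simp

lemma path_event_sets:
  assumes "\<And>j. j \<le> k \<Longrightarrow> y j \<in> S"
  shows "path_event k y \<in> events"
proof -
  have "{\<omega> \<in> space M. Y j \<omega> = y j \<and> 0 < H j \<omega> \<and> H j \<omega> < top} \<in> events" if "j \<in> {..k}" for j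
  proof -
    have "{\<omega> \<in> space M. Y j \<omega> = y j \<and> 0 < H j \<omega> \<and> H j \<omega> < top}
      = {\<omega> \<in> space M. Y j \<omega> = y j} \<inter> {\<omega> \<in> space M. 0 < H j \<omega> \<and> H j \<omega> < top}" by auto
    also have "\<dots> \<in> events"
      using Y_eq_event[OF assms[of j], of j] that by (intro sets.Int) auto
    finally show ?thesis .
  qed
  then have "{\<omega> \<in> space M. \<forall>j\<in>{..k}. Y j \<omega> = y j \<and> 0 < H j \<omega> \<and> H j \<omega> < top} \<in> events"
    by (intro sets.sets_Collect_finite_All) auto
  then show ?thesis unfolding path_event_def by (simp only: Ball_def atMost_iff)
qed

text \<open>The law of the chain speaks of tails with values in \<open>[0, \<infinity>]\<close>.
  Infinite holding times are removed as null sets: their probability is at most that of the tail at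
  every \<open>N\<close>, which decays exponentially.\<close>

lemma path_event_tails:
  assumes y: "\<And>j. j \<le> k \<Longrightarrow> y j \<in> S"
    and pos: "\<And>j. j \<le> k \<Longrightarrow> 0 < exit_rate L (y j)"
    and s: "\<And>j. j \<le> k \<Longrightarrow> 0 \<le> s j"
  shows "prob {\<omega> \<in> path_event k y. \<forall>j\<le>k. s j < enn2real (H j \<omega>)}
    = path_prob k y * (\<Prod>j\<le>k. exp (- exit_rate L (y j) * s j))"
proof -
  define U where "U s = {\<omega> \<in> space M. \<forall>j\<le>k. Y j \<omega> = y j \<and> ennreal (s j) < H j \<omega>}" for s :: "nat \<Rightarrow> real"
  have U_ev: "U s \<in> events" for s
  proof -
    have "{\<omega> \<in> space M. Y j \<omega> = y j \<and> ennreal (s j) < H j \<omega>} \<in> events" if "j \<in> {..k}" for j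
    proof -
      have "{\<omega> \<in> space M. Y j \<omega> = y j \<and> ennreal (s j) < H j \<omega>}
        = {\<omega> \<in> space M. Y j \<omega> = y j} \<inter> {\<omega> \<in> space M. ennreal (s j) < H j \<omega>}" by auto
      also have "\<dots> \<in> events"
        using Y_eq_event[OF y[of j], of j] that by (intro sets.Int) auto
      finally show ?thesis .
    qed
    then have "{\<omega> \<in> space M. \<forall>j\<in>{..k}. Y j \<omega> = y j \<and> ennreal (s j) < H j \<omega>} \<in> events"
      by (intro sets.sets_Collect_finite_All) auto
    then show ?thesis unfolding U_def by (simp only: Ball_def atMost_iff)
  qed
  have U_prob: "prob (U s) = path_prob k y * (\<Prod>j\<le>k. exp (- exit_rate L (y j) * s j))"
    if "\<And>j. j \<le> k \<Longrightarrow> 0 \<le> s j" for s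
    unfolding U_def path_prob_def using y that by (intro path_law) auto
  define I where "I i = {\<omega> \<in> U (\<lambda>_. 0). H i \<omega> = top}" for i
  have I_null: "I i \<in> null_sets M" if i: "i \<le> k" for i
  proof -
    have Iev: "I i \<in> events"
    proof -
      have "I i = U (\<lambda>_. 0) \<inter> {\<omega> \<in> space M. H i \<omega> = top}" unfolding I_def U_def by blast
      also have "\<dots> \<in> events" by (intro sets.Int U_ev) measurable
      finally show ?thesis .
    qed
    have "prob (I i) \<le> path_prob k y * exp (- exit_rate L (y i) * real N)" for N
    proof -
      define s' where "s' j = (if j = i then real N else 0)" for j
      have "I i \<subseteq> U s'" by (auto simp: I_def U_def s'_def ennreal_of_nat_eq_real_of_nat[symmetric] of_nat_less_top)
      then have "prob (I i) \<le> prob (U s')" using U_ev by (intro finite_measure_mono)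
      also have "\<dots> = path_prob k y * (\<Prod>j\<le>k. exp (- exit_rate L (y j) * s' j))"
        by (rule U_prob) (simp add: s'_def)
      also have "(\<Prod>j\<le>k. exp (- exit_rate L (y j) * s' j)) = (\<Prod>j\<in>{i}. exp (- exit_rate L (y j) * s' j))"
        using i by (intro prod.mono_neutral_right) (auto simp: s'_def)
      finally show ?thesis by (simp add: s'_def)
    qed
    moreover have "(\<lambda>N. path_prob k y * exp (- exit_rate L (y i) * real N)) \<longlonglongrightarrow> path_prob k y * 0"
    proof (intro tendsto_mult tendsto_const)
      have e: "exp (- exit_rate L (y i) * real N) = exp (- exit_rate L (y i)) ^ N" for N
        by (simp add: exp_of_nat_mult[symmetric] mult.commute)
      show "(\<lambda>N. exp (- exit_rate L (y i) * real N)) \<longlonglongrightarrow> 0"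
        unfolding e using pos[OF i] by (intro LIMSEQ_power_zero) simp
    qed
    ultimately have "prob (I i) \<le> 0"
      by (intro LIMSEQ_le_const) auto
    then have "prob (I i) = 0" by (simp add: measure_le_0_iff)
    then show ?thesis using Iev by (intro null_setsI) (auto simp: emeasure_eq_measure)
  qed
  have "{\<omega> \<in> path_event k y. \<forall>j\<le>k. s j < enn2real (H j \<omega>)} = U s - (\<Union>i\<in>{..k}. I i)"
  proof (intro set_eqI iffI)
    fix \<omega> assume w: "\<omega> \<in> {\<omega> \<in> path_event k y. \<forall>j\<le>k. s j < enn2real (H j \<omega>)}"
    have "ennreal (s j) < H j \<omega>" if "j \<le> k" for j
    proof -
      have "ennreal (s j) < ennreal (enn2real (H j \<omega>))"
        using w that s[OF that] by (intro ennreal_lessI) auto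
      then show ?thesis using w that by (simp add: path_event_def)
    qed
    then show "\<omega> \<in> U s - (\<Union>i\<in>{..k}. I i)" using w by (auto simp: U_def I_def path_event_def)
  next
    fix \<omega> assume w: "\<omega> \<in> U s - (\<Union>i\<in>{..k}. I i)"
    have lt: "ennreal (s j) < H j \<omega>" if "j \<le> k" for j using w that by (auto simp: U_def)
    have pos0: "0 < H j \<omega>" if "j \<le> k" for j using lt[OF that] by (simp add: le_less_trans[OF zero_le])
    have "\<omega> \<in> U (\<lambda>_. 0)" using w pos0 by (auto simp: U_def)
    then have fin: "H j \<omega> < top" if "j \<le> k" for j using w that by (auto simp: I_def less_top[symmetric])
    have "s j < enn2real (H j \<omega>)" if "j \<le> k" for j
      using lt[OF that] fin[OF that] s[OF that]
      by (cases "H j \<omega>") (auto simp: ennreal_less_iff)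
    then show "\<omega> \<in> {\<omega> \<in> path_event k y. \<forall>j\<le>k. s j < enn2real (H j \<omega>)}"
      using w pos0 fin by (auto simp: path_event_def U_def)
  qed
  moreover have "(\<Union>i\<in>{..k}. I i) \<in> null_sets M" using I_null by (intro null_sets.finite_UN) auto
  ultimately show ?thesis using U_prob[OF s] measure_Diff_null_set[OF U_ev] by simp
qed

lemma prob_path_event:
  assumes y: "\<And>j. j \<le> k \<Longrightarrow> y j \<in> S" and pos: "\<And>j. j \<le> k \<Longrightarrow> 0 < exit_rate L (y j)"
  shows "prob (path_event k y) = path_prob k y"
proof -
  have "{\<omega> \<in> path_event k y. \<forall>j\<le>k. 0 < enn2real (H j \<omega>)} = path_event k y"
    by (auto simp: path_event_def enn2real_positive_iff)
  then show ?thesis using path_event_tails[of k y "\<lambda>_. 0"] y pos by simp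
qed

text \<open>Conditioned on the path event, the joint tails factorise, so the holding times are
  independent exponentials. The conditioning needs positive probability; for a path of probability 0
  both sides vanish.\<close>

lemma jump_time_law_on_path:
  assumes y: "\<And>j. j \<le> k \<Longrightarrow> y j \<in> S"
    and pos: "\<And>j. j \<le> k \<Longrightarrow> 0 < exit_rate L (y j)"
    and i: "i \<le> Suc k" and t: "0 \<le> t"
  shows "prob {\<omega> \<in> path_event k y. jump_time i \<omega> \<le> ennreal t}
    = path_prob k y * measure (exp_sum (\<lambda>j. exit_rate L (y j)) i) {..t}"
proof -
  let ?B = "path_event k y" and ?q = "\<lambda>j. exit_rate L (y j)"
  define R where "R j \<omega> = enn2real (H j \<omega>)" for j \<omega>
  have R_meas [measurable]: "R j \<in> borel_measurable M" for j unfolding R_def by measurable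
  have B_ev [measurable]: "?B \<in> events" using y by (rule path_event_sets)
  have W: "prob ?B = path_prob k y" using prob_path_event y pos by blast
  have ev_eq: "{\<omega> \<in> ?B. jump_time i \<omega> \<le> ennreal t} = ?B \<inter> {\<omega> \<in> space M. (\<Sum>j<i. R j \<omega>) \<le> t}"
  proof -
    have "jump_time i \<omega> = ennreal (\<Sum>j<i. R j \<omega>)" if "\<omega> \<in> ?B" for \<omega>
    proof -
      have "jump_time i \<omega> = (\<Sum>j<i. ennreal (R j \<omega>))"
        unfolding jump_time_def using that i
        by (intro sum.cong) (auto simp: R_def path_event_def)
      also have "\<dots> = ennreal (\<Sum>j<i. R j \<omega>)" by (rule sum_ennreal) (simp add: R_def)
      finally show ?thesis .
    qed
    moreover have "?B \<subseteq> space M" by (auto simp: path_event_def)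
    ultimately show ?thesis using t by (auto simp: sum_nonneg R_def)
  qed
  show ?thesis
  proof (cases "path_prob k y = 0")
    case True
    have "prob {\<omega> \<in> ?B. jump_time i \<omega> \<le> ennreal t} \<le> prob ?B"
      by (intro finite_measure_mono) auto
    then show ?thesis using W True by (simp add: measure_le_0_iff)
  next
    case False
    have em: "emeasure M ?B \<noteq> 0" "emeasure M ?B \<noteq> \<infinity>" using False by (auto simp: emeasure_eq_measure measure_eq_0_null_sets simp flip: W)
    let ?P = "uniform_measure M ?B"
    interpret P: prob_space ?P using em by (rule prob_space_uniform_measure)
    have tails: "P.prob {\<omega> \<in> space ?P. \<forall>j\<in>{..k}. s j < R j \<omega>} = (\<Prod>j\<in>{..k}. exp (- ?q j * s j))"
      if s: "\<And>j. j \<in> {..k} \<Longrightarrow> 0 \<le> s j" for s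
    proof -
      have ev: "{\<omega> \<in> space M. \<forall>j\<in>{..k}. s j < R j \<omega>} \<in> events" by measurable
      have "P.prob {\<omega> \<in> space ?P. \<forall>j\<in>{..k}. s j < R j \<omega>}
          = prob (?B \<inter> {\<omega> \<in> space M. \<forall>j\<in>{..k}. s j < R j \<omega>}) / prob ?B"
        using measure_uniform_measure[OF em ev] by simp
      also have "?B \<inter> {\<omega> \<in> space M. \<forall>j\<in>{..k}. s j < R j \<omega>} = {\<omega> \<in> ?B. \<forall>j\<le>k. s j < enn2real (H j \<omega>)}"
        by (auto simp: R_def path_event_def)
      also have "prob \<dots> = path_prob k y * (\<Prod>j\<le>k. exp (- ?q j * s j))"
        by (rule path_event_tails) (use y pos s in auto)
      finally show ?thesis using W False by simp
    qed
    have ind: "P.indep_vars (\<lambda>_. borel) R {..k}"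
      and dist: "\<And>j. j \<in> {..k} \<Longrightarrow> distributed ?P lborel (R j) (exponential_density (?q j))"
      using P.indep_exponential_of_joint_tails[of "{..k}" R ?q] tails pos by auto
    have law: "distr ?P borel (\<lambda>\<omega>. \<Sum>j<i. R j \<omega>) = exp_sum ?q i"
      by (rule P.distr_partial_sum_exponential[of R "Suc k"])
         (use ind dist i in \<open>auto simp: lessThan_Suc_atMost\<close>)
    have ev: "{\<omega> \<in> space M. (\<Sum>j<i. R j \<omega>) \<le> t} \<in> events" by measurable
    have "measure (exp_sum ?q i) {..t} = P.prob ((\<lambda>\<omega>. \<Sum>j<i. R j \<omega>) -` {..t} \<inter> space ?P)"
      unfolding law[symmetric] by (intro measure_distr) auto
    also have "(\<lambda>\<omega>. \<Sum>j<i. R j \<omega>) -` {..t} \<inter> space ?P = {\<omega> \<in> space M. (\<Sum>j<i. R j \<omega>) \<le> t}" by auto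
    also have "P.prob \<dots> = prob (?B \<inter> {\<omega> \<in> space M. (\<Sum>j<i. R j \<omega>) \<le> t}) / prob ?B"
      by (rule measure_uniform_measure[OF em ev])
    finally show ?thesis using W False ev_eq by simp
  qed
qed

text \<open>The event \<open>T k \<le> t < T (k+1)\<close> is a difference of two nested events,
  hence the marginal laws of \<open>T k\<close> and \<open>T (k+1)\<close> suffice.\<close>

lemma holding_law_on_path:
  assumes y: "\<And>j. j \<le> k \<Longrightarrow> y j \<in> S"
    and pos: "\<And>j. j \<le> k \<Longrightarrow> 0 < exit_rate L (y j)" and t: "0 \<le> t"
  defines "N \<equiv> exp_sum (\<lambda>j. exit_rate L (y j))"
  shows "prob {\<omega> \<in> path_event k y. jump_time k \<omega> \<le> ennreal t \<and> ennreal t < jump_time (Suc k) \<omega>}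
    = path_prob k y * (measure (N k) {..t} - measure (N (Suc k)) {..t})"
proof -
  have [measurable]: "path_event k y \<in> events" using y by (rule path_event_sets)
  have sp: "path_event k y \<subseteq> space M" by (auto simp: path_event_def)
  let ?A = "\<lambda>i. {\<omega> \<in> path_event k y. jump_time i \<omega> \<le> ennreal t}"
  have ev: "?A i \<in> events" for i
  proof -
    have "?A i = path_event k y \<inter> {\<omega> \<in> space M. jump_time i \<omega> \<le> ennreal t}" using sp by auto
    then show ?thesis by simp
  qed
  have "{\<omega> \<in> path_event k y. jump_time k \<omega> \<le> ennreal t \<and> ennreal t < jump_time (Suc k) \<omega>} = ?A k - ?A (Suc k)"
    by auto
  moreover have "?A (Suc k) \<subseteq> ?A k" using jump_time_mono[of k "Suc k"] by (auto intro: order_trans)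
  ultimately have "prob {\<omega> \<in> path_event k y. jump_time k \<omega> \<le> ennreal t \<and> ennreal t < jump_time (Suc k) \<omega>}
    = prob (?A k) - prob (?A (Suc k))" using ev by (simp add: finite_measure_Diff)
  also have "\<dots> = path_prob k y * (measure (N k) {..t} - measure (N (Suc k)) {..t})"
    unfolding N_def using jump_time_law_on_path[of k y k t] jump_time_law_on_path[of k y "Suc k" t] y pos t
    by (simp add: algebra_simps)
  finally show ?thesis .
qed

end

section \<open>Survival of a chain with a bounded decaying function\<close>

text \<open>The chain is observed until it leaves \<open>A\<close>; \<open>targets x\<close> is a
  finite set of states of \<open>A\<close> that carries the jumps from \<open>x\<close> which matter
  for \<open>\<psi>\<close>. The assumption \<open>psi_decay\<close> says
  \<open>L \<psi> \<ge> - J \<psi>\<close> for the chain killed outside \<open>A\<close>, written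
  for the jump chain. The function \<open>size\<close> rules out explosion in \<open>A\<close>: it
  grows at most by 1 per jump and controls the exit rate linearly.\<close>

locale killed_chain = jump_holding_chain M S L \<mu> X Y H
  for M :: "'w measure" and S :: "'s set" and L \<mu> X Y H +
  fixes A :: "'s set" and targets :: "'s \<Rightarrow> 's set" and size :: "'s \<Rightarrow> nat" and \<psi> :: "'s \<Rightarrow> real"
    and K J :: real
  assumes A_subset: "A \<subseteq> S"
    and exit_rate_pos: "x \<in> A \<Longrightarrow> 0 < exit_rate L x"
    and exit_rate_le: "x \<in> A \<Longrightarrow> exit_rate L x \<le> K * (1 + real (size x))"
    and targets_finite: "x \<in> A \<Longrightarrow> finite (targets x)"
    and targets_subset: "x \<in> A \<Longrightarrow> targets x \<subseteq> A"
    and targets_size: "x \<in> A \<Longrightarrow> v \<in> targets x \<Longrightarrow> size v \<le> Suc (size x)"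
    and jump_prob_nonneg: "x \<in> A \<Longrightarrow> v \<in> targets x \<Longrightarrow> 0 \<le> jump_prob L x v"
    and jump_prob_sum: "x \<in> A \<Longrightarrow> (\<Sum>v\<in>targets x. jump_prob L x v) \<le> 1"
    and psi_nonneg: "x \<in> A \<Longrightarrow> 0 \<le> \<psi> x"
    and psi_le_1: "x \<in> A \<Longrightarrow> \<psi> x \<le> 1"
    and psi_decay: "x \<in> A \<Longrightarrow> (1 - J / exit_rate L x) * \<psi> x \<le> (\<Sum>v\<in>targets x. jump_prob L x v * \<psi> v)"
    and K_pos: "0 < K" and J_nonneg: "0 \<le> J"
begin

text \<open>Survival in \<open>A\<close> up to time \<open>t\<close>, where the state occupied at
  time \<open>t\<close> is reached after at least \<open>k\<close> and fewer than
  \<open>k + m\<close> jumps. Both bounds are needed for an induction on \<open>m\<close> along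
  growing paths.\<close>

definition survival :: "real \<Rightarrow> nat \<Rightarrow> nat \<Rightarrow> 'w set" where
  "survival t k m = {\<omega> \<in> space M. \<exists>j\<in>{k..<k + m}. jump_time j \<omega> \<le> ennreal t \<and>
     ennreal t < jump_time (Suc j) \<omega> \<and> (\<forall>i\<in>{..j}. Y i \<omega> \<in> A)}"

lemma survival_event: "survival t k m \<in> events"
proof -
  have [measurable]: "Measurable.pred M (\<lambda>\<omega>. Y i \<omega> \<in> A)" for i
    using Y_in_event[OF A_subset] by (simp add: pred_def)
  show ?thesis unfolding survival_def by measurable
qed

abbreviation path_sum_law :: "(nat \<Rightarrow> 's) \<Rightarrow> nat \<Rightarrow> real measure" where
  "path_sum_law y \<equiv> exp_sum (\<lambda>j. exit_rate L (y j))"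

abbreviation path_laplace :: "nat \<Rightarrow> (nat \<Rightarrow> 's) \<Rightarrow> real" where
  "path_laplace k y \<equiv> (\<Prod>j<k. exit_rate L (y j) / (exit_rate L (y j) + K))"

text \<open>Either the chain still sits in \<open>y k\<close> at time \<open>t\<close>, or it has
  made one more jump before; the latter events are disjoint for different targets.\<close>

lemma survival_split:
  assumes y: "\<And>i. i \<le> k \<Longrightarrow> y i \<in> A"
  shows "prob {\<omega> \<in> path_event k y. jump_time k \<omega> \<le> ennreal t \<and> ennreal t < jump_time (Suc k) \<omega>}
      + (\<Sum>v\<in>targets (y k). prob (path_event (Suc k) (y(Suc k := v)) \<inter> survival t (Suc k) m))
    \<le> prob (path_event k y \<inter> survival t k (Suc m))"
proof -
  have yk: "y k \<in> A" using y by simp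
  define E where "E = {\<omega> \<in> path_event k y. jump_time k \<omega> \<le> ennreal t \<and> ennreal t < jump_time (Suc k) \<omega>}"
  define F where "F v = path_event (Suc k) (y(Suc k := v)) \<inter> survival t (Suc k) m" for v
  have sp: "path_event i u \<subseteq> space M" for i u by (auto simp: path_event_def)
  have pe: "path_event k y \<in> events" using y A_subset by (intro path_event_sets) auto
  have Eev: "E \<in> events"
  proof -
    have "E = path_event k y \<inter> {\<omega> \<in> space M. jump_time k \<omega> \<le> ennreal t \<and> ennreal t < jump_time (Suc k) \<omega>}"
      unfolding E_def using sp by blast
    also have "\<dots> \<in> events" by (intro sets.Int pe) measurable
    finally show ?thesis .
  qed
  have Fev: "F v \<in> events" if v: "v \<in> targets (y k)" for v
    unfolding F_def
  proof (intro sets.Int survival_event path_event_sets)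
    fix j assume "j \<le> Suc k"
    then show "(y(Suc k := v)) j \<in> S"
      using y[of j] v targets_subset[OF yk] A_subset by (cases "j = Suc k") auto
  qed
  have disjF: "disjoint_family_on F (targets (y k))"
    unfolding disjoint_family_on_def
  proof (intro ballI impI)
    fix u v :: 's assume "u \<noteq> v"
    have "Y (Suc k) \<omega> = w" if "\<omega> \<in> F w" for \<omega> w
      using that unfolding F_def path_event_def by auto
    then show "F u \<inter> F v = {}" using \<open>u \<noteq> v\<close> by blast
  qed
  have late: "jump_time (Suc k) \<omega> \<le> ennreal t" if w: "\<omega> \<in> F v" for v \<omega>
  proof -
    obtain j where "Suc k \<le> j" "jump_time j \<omega> \<le> ennreal t"
      using w unfolding F_def survival_def by auto
    then show ?thesis using jump_time_mono[of "Suc k" j \<omega>] order_trans by blast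
  qed
  have "prob E + (\<Sum>v\<in>targets (y k). prob (F v)) = prob E + prob (\<Union>v\<in>targets (y k). F v)"
    using Fev disjF targets_finite[OF yk] by (subst finite_measure_finite_Union) auto
  also have "\<dots> = prob (E \<union> (\<Union>v\<in>targets (y k). F v))"
  proof (rule finite_measure_Union[symmetric])
    show "E \<inter> (\<Union>v\<in>targets (y k). F v) = {}"
      using late unfolding E_def by fastforce
  qed (use Eev Fev targets_finite[OF yk] in auto)
  also have "\<dots> \<le> prob (path_event k y \<inter> survival t k (Suc m))"
  proof (rule finite_measure_mono)
    have "E \<subseteq> path_event k y \<inter> survival t k (Suc m)"
    proof
      fix \<omega> assume w: "\<omega> \<in> E"
      have "Y i \<omega> \<in> A" if "i \<le> k" for i
        using w y[OF that] that unfolding E_def path_event_def by auto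
      then show "\<omega> \<in> path_event k y \<inter> survival t k (Suc m)"
        using w sp unfolding E_def survival_def by (auto intro!: bexI[of _ k])
    qed
    moreover have "F v \<subseteq> path_event k y \<inter> survival t k (Suc m)" for v
    proof
      fix \<omega> assume w: "\<omega> \<in> F v"
      have "\<omega> \<in> path_event k y"
        using w unfolding F_def path_event_def by (auto dest: le_SucI)
      moreover have "\<omega> \<in> survival t k (Suc m)"
        using w unfolding F_def survival_def by fastforce
      ultimately show "\<omega> \<in> path_event k y \<inter> survival t k (Suc m)" by blast
    qed
    ultimately show "E \<union> (\<Union>v\<in>targets (y k). F v) \<subseteq> path_event k y \<inter> survival t k (Suc m)" by blast
    show "path_event k y \<inter> survival t k (Suc m) \<in> events" by (intro sets.Int pe survival_event)
  qed
  finally show ?thesis unfolding E_def F_def .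
qed

text \<open>The right-hand side carries the error made by stopping after \<open>m\<close> further
  jumps. Its last factor bounds the product of \<open>q/(q + K)\<close> over these jumps: if the
  size is \<open>N\<close>, then \<open>q \<le> K (1 + N)\<close> gives
  \<open>q/(q + K) \<le> (1 + N)/(2 + N)\<close>, and sizes grow at most by 1, so the product
  telescopes to \<open>(1 + N)/(1 + N + m)\<close>.\<close>

lemma survival_induct:
  assumes t: "0 \<le> t" and y: "\<And>i. i \<le> k \<Longrightarrow> y i \<in> A"
  shows "path_prob k y * \<psi> (y k) * discount J t (path_sum_law y k)
    \<le> prob (path_event k y \<inter> survival t k m)
      + exp (K * t) * path_prob k y * path_laplace k y * ((1 + real (size (y k))) / (1 + real (size (y k)) + real m))"
  using y
proof (induction m arbitrary: k y)
  case 0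
  have y: "\<And>i. i \<le> k \<Longrightarrow> y i \<in> A" by (rule 0)
  have W: "0 \<le> path_prob k y" 
    using prob_path_event[of k y] y A_subset exit_rate_pos by (metis measure_nonneg subset_iff)
  interpret N: prob_space "path_sum_law y k"
    using y exit_rate_pos by (intro prob_space_exp_sum) auto
  have "discount J t (path_sum_law y k) \<le> measure (path_sum_law y k) {..t}"
    by (intro discount_le_measure N.finite_measure_axioms J_nonneg) simp
  also have "\<dots> \<le> exp (K * t) * path_laplace k y"
    using y exit_rate_pos by (intro exp_sum_atMost_le K_pos) auto
  finally have d: "discount J t (path_sum_law y k) \<le> exp (K * t) * path_laplace k y" .
  have d0: "0 \<le> discount J t (path_sum_law y k)"
    by (rule discount_nonneg)
  have "path_prob k y * \<psi> (y k) * discount J t (path_sum_law y k)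
      \<le> path_prob k y * 1 * discount J t (path_sum_law y k)"
    using W d0 psi_le_1[OF y[OF order_refl]] by (intro mult_right_mono mult_left_mono) auto
  also have "\<dots> \<le> path_prob k y * (exp (K * t) * path_laplace k y)"
    using W d by (simp add: mult_left_mono)
  finally show ?case by (simp add: survival_def algebra_simps)
next
  case (Suc m)
  have y: "\<And>i. i \<le> k \<Longrightarrow> y i \<in> A" by (rule Suc.prems)
  have yk: "y k \<in> A" using y by simp
  define q where "q = exit_rate L (y k)"
  define W where "W = path_prob k y"
  define p where "p v = jump_prob L (y k) v" for v
  define l where "l = path_laplace k y"
  define n where "n = real (size (y k))"
  define D where "D i = discount J t (path_sum_law y i)" for i
  define F where "F i = measure (path_sum_law y i) {..t}" for i
  define V where "V = prob {\<omega> \<in> path_event k y. jump_time k \<omega> \<le> ennreal t \<and> ennreal t < jump_time (Suc k) \<omega>}"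
  define V' where "V' v = prob (path_event (Suc k) (y(Suc k := v)) \<inter> survival t (Suc k) m)" for v
  have q: "0 < q" using exit_rate_pos[OF yk] by (simp add: q_def)
  have W0: "0 \<le> W" unfolding W_def
    using prob_path_event[of k y] y A_subset exit_rate_pos by (metis measure_nonneg subset_iff)
  have l0: "0 \<le> l" unfolding l_def
  proof (rule prod_nonneg)
    fix j assume "j \<in> {..<k}"
    then have "0 < exit_rate L (y j)" by (intro exit_rate_pos y) simp
    then show "0 \<le> exit_rate L (y j) / (exit_rate L (y j) + K)" using K_pos by simp
  qed
  have n0: "0 \<le> n" by (simp add: n_def)
  have D0: "0 \<le> D i" for i unfolding D_def by (rule discount_nonneg)
  have V_eq: "V = W * (F k - F (Suc k))"
    unfolding V_def W_def F_def using y A_subset exit_rate_pos t by (intro holding_law_on_path) auto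
  have step: "(1 - J / q) * D (Suc k) - F (Suc k) = D k - F k"
    unfolding D_def F_def q_def exp_sum.simps
    using y exit_rate_pos by (intro discount_exp_step prob_space_exp_sum J_nonneg) auto
  have p0: "0 \<le> p v" if "v \<in> targets (y k)" for v
    using jump_prob_nonneg[OF yk that] by (simp add: p_def)
  have IH: "W * p v * \<psi> v * D (Suc k)
      \<le> V' v + exp (K * t) * (W * p v) * (l * (q / (q + K))) * ((n + 2) / (n + 2 + m))"
    if v: "v \<in> targets (y k)" for v
  proof -
    let ?y = "y(Suc k := v)"
    have e1: "path_prob (Suc k) ?y = W * p v"
      by (simp add: path_prob_def W_def p_def)
    have e2: "path_laplace (Suc k) ?y = l * (q / (q + K))"
      by (simp add: l_def q_def)
    have e3: "path_sum_law ?y (Suc k) = path_sum_law y (Suc k)"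
      by (rule exp_sum_cong) auto
    have e4: "?y i \<in> A" if "i \<le> Suc k" for i
      using y[of i] v targets_subset[OF yk] that by (cases "i = Suc k") auto
    have e5: "?y (Suc k) = v" by simp
    have "W * p v * \<psi> v * D (Suc k)
      \<le> V' v + exp (K * t) * (W * p v) * (l * (q / (q + K))) * ((1 + real (size v)) / (1 + real (size v) + real m))"
      using Suc.IH[of "Suc k" ?y, OF e4] unfolding e1 e2 e3 e5 D_def V'_def .
    moreover have "(1 + real (size v)) / (1 + real (size v) + real m) \<le> (n + 2) / (n + 2 + m)"
    proof -
      have sv: "real (size v) \<le> n + 1" using targets_size[OF yk v] by (simp add: n_def)
      then have "real m * real (size v) \<le> real m * (n + 1)" by (intro mult_left_mono) auto
      then show ?thesis using n0 by (simp add: frac_le_eq divide_simps) (simp add: algebra_simps)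
    qed
    moreover have "0 \<le> exp (K * t) * (W * p v) * (l * (q / (q + K)))"
      using W0 p0[OF v] l0 q K_pos by simp
    ultimately show ?thesis
      using mult_left_mono[of "(1 + real (size v)) / (1 + real (size v) + real m)" "(n + 2) / (n + 2 + m)"
        "exp (K * t) * (W * p v) * (l * (q / (q + K)))"] by linarith
  qed
  \<comment> \<open>The discount step replaces \<open>D k\<close> by \<open>D (Suc k)\<close>; \<open>\<psi> \<le> 1\<close> is used on the holding term,
      the decay of \<open>\<psi>\<close> on the other.\<close>
  have "W * \<psi> (y k) * D k = \<psi> (y k) * V + W * D (Suc k) * ((1 - J / q) * \<psi> (y k))"
  proof -
    have "D k = (1 - J / q) * D (Suc k) - F (Suc k) + F k" using step by simp
    then have "W * \<psi> (y k) * D k = W * \<psi> (y k) * ((1 - J / q) * D (Suc k) - F (Suc k) + F k)" by simp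
    then show ?thesis unfolding V_eq by (simp only: algebra_simps)
  qed
  also have "\<dots> \<le> V + W * D (Suc k) * (\<Sum>v\<in>targets (y k). p v * \<psi> v)"
  proof (intro add_mono mult_left_mono)
    show "\<psi> (y k) * V \<le> V"
      using psi_nonneg[OF yk] psi_le_1[OF yk] by (intro mult_left_le_one_le) (auto simp: V_def)
    show "(1 - J / q) * \<psi> (y k) \<le> (\<Sum>v\<in>targets (y k). p v * \<psi> v)"
      using psi_decay[OF yk] by (simp add: q_def p_def)
  qed (use W0 D0 in simp)
  also have "W * D (Suc k) * (\<Sum>v\<in>targets (y k). p v * \<psi> v) = (\<Sum>v\<in>targets (y k). W * p v * \<psi> v * D (Suc k))"
    by (simp add: sum_distrib_left algebra_simps)
  also have "\<dots> \<le> (\<Sum>v\<in>targets (y k). V' v + exp (K * t) * (W * p v) * (l * (q / (q + K))) * ((n + 2) / (n + 2 + m)))"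
    by (intro sum_mono IH)
  also have "\<dots> = (\<Sum>v\<in>targets (y k). V' v) + exp (K * t) * W * l * ((q / (q + K)) * ((n + 2) / (n + 2 + m)) * (\<Sum>v\<in>targets (y k). p v))"
  proof -
    have "(\<Sum>v\<in>targets (y k). exp (K * t) * (W * p v) * (l * (q / (q + K))) * ((n + 2) / (n + 2 + m)))
        = (\<Sum>v\<in>targets (y k). exp (K * t) * W * l * ((q / (q + K)) * ((n + 2) / (n + 2 + m))) * p v)"
      by (simp only: mult_ac)
    then show ?thesis by (simp only: sum.distrib sum_distrib_left[symmetric] mult.assoc)
  qed
  finally have main: "W * \<psi> (y k) * D k \<le> V + ((\<Sum>v\<in>targets (y k). V' v)
    + exp (K * t) * W * l * ((q / (q + K)) * ((n + 2) / (n + 2 + m)) * (\<Sum>v\<in>targets (y k). p v)))"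
    by simp
  have "(q / (q + K)) * ((n + 2) / (n + 2 + m)) * (\<Sum>v\<in>targets (y k). p v) \<le> (1 + n) / (2 + n) * ((n + 2) / (n + 2 + m)) * 1"
  proof (intro mult_mono)
    have "q \<le> K * (1 + n)" using exit_rate_le[OF yk] by (simp add: q_def n_def)
    then show "q / (q + K) \<le> (1 + n) / (2 + n)"
      using q K_pos n0 by (simp add: divide_simps algebra_simps)
    show "(\<Sum>v\<in>targets (y k). p v) \<le> 1" using jump_prob_sum[OF yk] by (simp add: p_def)
  qed (use n0 q K_pos p0 in \<open>auto intro!: sum_nonneg\<close>)
  also have "(1 + n) / (2 + n) * ((n + 2) / (n + 2 + m)) * 1 = (1 + n) / (1 + n + real (Suc m))"
    using n0 by (simp add: divide_simps) (simp add: algebra_simps)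
  finally have "exp (K * t) * W * l * ((q / (q + K)) * ((n + 2) / (n + 2 + m)) * (\<Sum>v\<in>targets (y k). p v))
      \<le> exp (K * t) * W * l * ((1 + n) / (1 + n + real (Suc m)))"
    using W0 l0 by (intro mult_left_mono) auto
  moreover have "V + (\<Sum>v\<in>targets (y k). V' v) \<le> prob (path_event k y \<inter> survival t k (Suc m))"
    unfolding V_def V'_def by (rule survival_split[OF y])
  ultimately have "W * \<psi> (y k) * D k \<le> prob (path_event k y \<inter> survival t k (Suc m))
      + exp (K * t) * W * l * ((1 + n) / (1 + n + real (Suc m)))" using main by linarith
  then show ?case unfolding W_def D_def l_def n_def .
qed

lemma survival_from_state:
  assumes t: "0 \<le> t" and x: "x \<in> A"
  shows "pmf \<mu> x * \<psi> x * exp (- J * t)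
    \<le> prob ({\<omega> \<in> space M. Y 0 \<omega> = x} \<inter> {\<omega> \<in> space M. ereal t < exit_time A X \<omega>})" (is "_ \<le> ?r")
proof -
  let ?y = "\<lambda>_::nat. x"
  have d: "discount J t (path_sum_law ?y 0) = exp (- J * t)"
    unfolding discount_def exp_sum.simps using t by (subst integral_return) auto
  have bound: "pmf \<mu> x * \<psi> x * exp (- J * t)
    \<le> ?r + exp (K * t) * pmf \<mu> x * ((1 + real (size x)) / (1 + real (size x) + real m))" for m
  proof -
    have "path_event 0 ?y \<inter> survival t 0 m \<subseteq> {\<omega> \<in> space M. Y 0 \<omega> = x} \<inter> {\<omega> \<in> space M. ereal t < exit_time A X \<omega>}"
    proof
      fix \<omega> assume w: "\<omega> \<in> path_event 0 ?y \<inter> survival t 0 m"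
      then have sp: "\<omega> \<in> space M" and Y0: "Y 0 \<omega> = x" by (auto simp: path_event_def)
      obtain j where "jump_time j \<omega> \<le> ennreal t" "ennreal t < jump_time (Suc j) \<omega>" "\<forall>i\<le>j. Y i \<omega> \<in> A"
        using w unfolding survival_def by auto
      then have "ereal t < exit_time A X \<omega>" unfolding exit_time_gt_iff[OF sp t] by blast
      with sp Y0 show "\<omega> \<in> {\<omega> \<in> space M. Y 0 \<omega> = x} \<inter> {\<omega> \<in> space M. ereal t < exit_time A X \<omega>}" by simp
    qed
    then have "prob (path_event 0 ?y \<inter> survival t 0 m) \<le> ?r"
      using A_subset x t by (intro finite_measure_mono sets.Int Y_eq_event exit_time_gt_event) auto
    moreover have "path_prob 0 ?y = pmf \<mu> x" by (simp add: path_prob_def)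
    ultimately show ?thesis
      using survival_induct[OF t, of 0 ?y m] x unfolding d by simp
  qed
  have "(\<lambda>m. ?r + exp (K * t) * pmf \<mu> x * ((1 + real (size x)) / (1 + real (size x) + real m)))
    \<longlonglongrightarrow> ?r + exp (K * t) * pmf \<mu> x * 0"
  proof (intro tendsto_intros)
    have "filterlim (\<lambda>m. 1 + real (size x) + real m) at_top sequentially"
      by (intro filterlim_tendsto_add_at_top[OF tendsto_const] filterlim_real_sequentially)
    then show "(\<lambda>m. (1 + real (size x)) / (1 + real (size x) + real m)) \<longlonglongrightarrow> 0"
      by (intro tendsto_divide_0[OF tendsto_const] filterlim_at_top_imp_at_infinity)
  qed
  then have "pmf \<mu> x * \<psi> x * exp (- J * t) \<le> ?r + exp (K * t) * pmf \<mu> x * 0"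
    by (rule LIMSEQ_le_const) (use bound in auto)
  then show ?thesis by simp
qed

theorem survival_lower_bound:
  assumes t: "0 \<le> t" and supp: "set_pmf \<mu> \<subseteq> A"
  shows "measure_pmf.expectation \<mu> \<psi> * exp (- J * t) \<le> prob {\<omega> \<in> space M. ereal t < exit_time A X \<omega>}"
proof -
  let ?T = "{\<omega> \<in> space M. ereal t < exit_time A X \<omega>}"
  let ?E = "\<lambda>x. {\<omega> \<in> space M. Y 0 \<omega> = x} \<inter> ?T"
  have Tev: "?T \<in> events" using A_subset t by (rule exit_time_gt_event)
  have Eev: "?E x \<in> events" if "x \<in> set_pmf \<mu>" for x
    using that supp A_subset by (intro sets.Int Tev Y_eq_event) auto
  have psi0: "0 \<le> \<psi> x" if "x \<in> set_pmf \<mu>" for x using psi_nonneg that supp by auto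
  have int: "integrable (measure_pmf \<mu>) \<psi>"
    using psi_nonneg psi_le_1 supp
    by (intro measure_pmf.integrable_const_bound[where B=1]) (auto simp: AE_measure_pmf_iff subset_iff)
  have "ennreal (measure_pmf.expectation \<mu> \<psi> * exp (- J * t)) = (\<integral>\<^sup>+x. ennreal (\<psi> x * exp (- J * t)) \<partial>measure_pmf \<mu>)"
    using int psi0 by (subst nn_integral_eq_integral) (auto simp: AE_measure_pmf_iff)
  also have "\<dots> = (\<integral>\<^sup>+x. ennreal (pmf \<mu> x) * ennreal (\<psi> x * exp (- J * t)) \<partial>count_space UNIV)"
    by (rule nn_integral_measure_pmf)
  also have "\<dots> = (\<integral>\<^sup>+x. ennreal (pmf \<mu> x) * ennreal (\<psi> x * exp (- J * t)) * indicator (set_pmf \<mu>) x \<partial>count_space UNIV)"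
    by (intro nn_integral_cong) (auto simp: indicator_def pmf_eq_0_set_pmf)
  also have "\<dots> = (\<integral>\<^sup>+x. ennreal (pmf \<mu> x) * ennreal (\<psi> x * exp (- J * t)) \<partial>count_space (set_pmf \<mu>))"
    by (simp add: nn_integral_count_space_indicator)
  also have "\<dots> \<le> (\<integral>\<^sup>+x. emeasure M (?E x) \<partial>count_space (set_pmf \<mu>))"
  proof (intro nn_integral_mono)
    fix x assume "x \<in> space (count_space (set_pmf \<mu>))"
    then have x: "x \<in> set_pmf \<mu>" by simp
    have "ennreal (pmf \<mu> x) * ennreal (\<psi> x * exp (- J * t)) = ennreal (pmf \<mu> x * \<psi> x * exp (- J * t))"
      using psi0[OF x] by (simp add: ennreal_mult mult.assoc)
    also have "\<dots> \<le> ennreal (prob (?E x))"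
      using survival_from_state[OF t, of x] x supp by (intro ennreal_leI) auto
    finally show "ennreal (pmf \<mu> x) * ennreal (\<psi> x * exp (- J * t)) \<le> emeasure M (?E x)"
      by (simp add: emeasure_eq_measure)
  qed
  also have "\<dots> = emeasure M (\<Union>x\<in>set_pmf \<mu>. ?E x)"
    using Eev by (intro emeasure_UN_countable[symmetric]) (auto simp: disjoint_family_on_def)
  also have "\<dots> \<le> emeasure M ?T" using Tev by (intro emeasure_mono) auto
  finally show ?thesis by (simp add: emeasure_eq_measure)
qed

end

section \<open>The Becker--Doering eigenfunction\<close>

text \<open>Bernoulli's inequality for each factor; two numbers \<open>x, y \<le> 1\<close> satisfy
  \<open>x y \<ge> x + y - 1\<close>.\<close>

lemma prod_power_ge_1_minus_sum:
  fixes g :: "'i \<Rightarrow> real" and m :: "'i \<Rightarrow> nat"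
  assumes "finite I" "\<And>i. i \<in> I \<Longrightarrow> 0 \<le> g i" "\<And>i. i \<in> I \<Longrightarrow> g i \<le> 1"
  shows "1 - (\<Sum>i\<in>I. real (m i) * (1 - g i)) \<le> (\<Prod>i\<in>I. g i ^ m i)"
  using assms
proof (induction I rule: finite_induct)
  case (insert i I)
  let ?x = "g i ^ m i" and ?y = "\<Prod>i\<in>I. g i ^ m i"
  have "1 - real (m i) * (1 - g i) \<le> ?x"
    using Bernoulli_inequality[of "g i - 1" "m i"] insert.prems by (simp add: algebra_simps)
  moreover have "?x \<le> 1" using insert.prems by (intro power_le_one) auto
  moreover have "?y \<le> 1" using insert.prems by (intro prod_le_1) (auto intro: power_le_one)
  moreover have "0 \<le> (1 - ?x) * (1 - ?y)" using calculation by simp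
  moreover have "1 - (\<Sum>i\<in>I. real (m i) * (1 - g i)) \<le> ?y" using insert by auto
  ultimately show ?case using insert.hyps by (simp add: algebra_simps)
qed simp

lemma BD_states_upto_iff:
  "C \<in> BD_states_upto n \<longleftrightarrow> C 0 = 0 \<and> C 1 = 0 \<and> (\<forall>i>n. C i = 0)"
proof -
  have "summable (\<lambda>i. real (C i))" if "\<forall>i>n. C i = 0"
    by (rule summable_finite[of "{..n}"]) (use that in auto)
  then show ?thesis by (auto simp: BD_states_upto_def BD_states_def Suc_le_eq)
qed

locale BD_cutoff =
  fixes a b :: "nat \<Rightarrow> real" and z :: real and n :: nat
  assumes a_pos: "1 \<le> i \<Longrightarrow> 0 < a i" and b_pos: "2 \<le> i \<Longrightarrow> 0 < b i"
    and z_pos: "0 < z" and n_ge: "2 \<le> n"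
begin

abbreviation Q :: "nat \<Rightarrow> real" where "Q \<equiv> BD_Q a b"
abbreviation J :: real where "J \<equiv> BD_J a b z n"
abbreviation A :: "(nat \<Rightarrow> nat) set" where "A \<equiv> BD_states_upto n"

text \<open>In the birth-death chain followed by a single cluster, with reversible weights
  \<open>Q k z^k\<close>, this is the resistance of the edge from \<open>k\<close> to
  \<open>k + 1\<close>. The current \<open>J\<close> is the inverse of the total resistance, and
  \<open>G\<close> is the potential: 1 at size 1 and 0 at size \<open>n + 1\<close>.\<close>

definition resist :: "nat \<Rightarrow> real" where "resist k = 1 / (a k * Q k * z ^ (k + 1))"

definition G :: "nat \<Rightarrow> real" where "G i = BD_f a b z n i / (Q i * z ^ i)"

definition psi :: "(nat \<Rightarrow> nat) \<Rightarrow> real" where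
  "psi C = (\<Prod>i=2..n. G i ^ C i)"

lemma Q_1 [simp]: "Q (Suc 0) = 1"
  by (simp add: BD_Q_def)

lemma Q_pos: "1 \<le> i \<Longrightarrow> 0 < Q i"
  unfolding BD_Q_def using a_pos b_pos by (auto intro!: divide_pos_pos prod_pos)

lemma Q_step: "1 \<le> i \<Longrightarrow> b (Suc i) * Q (Suc i) = a i * Q i"
proof -
  assume i: "1 \<le> i"
  have 1: "(\<Prod>j=1..<Suc i. a j) = (\<Prod>j=1..<i. a j) * a i"
    using i by (simp add: prod.atLeastLessThan_Suc)
  have 2: "(\<Prod>j=2..Suc i. b j) = (\<Prod>j=2..i. b j) * b (Suc i)"
    using i by (subst prod.nat_ivl_Suc') (auto simp: mult.commute)
  have "b (Suc i) \<noteq> 0" using b_pos[of "Suc i"] i by simp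
  then show ?thesis unfolding BD_Q_def 1 2 by simp
qed

lemma resist_pos: "1 \<le> k \<Longrightarrow> 0 < resist k"
  unfolding resist_def using a_pos Q_pos z_pos by auto

lemma J_eq: "J = inverse (\<Sum>k=1..n. resist k)"
  by (simp add: BD_J_def resist_def)

lemma sum_resist_pos: "0 < (\<Sum>k=1..n. resist k)"
  using resist_pos n_ge by (intro sum_pos) auto

lemma J_pos: "0 < J"
  unfolding J_eq using sum_resist_pos by simp

lemma G_eq: "1 \<le> i \<Longrightarrow> G i = J * (\<Sum>k=i..n. resist k)"
  using Q_pos[of i] z_pos by (simp add: G_def BD_f_def resist_def)

lemma G_1: "G 1 = 1"
  using sum_resist_pos by (subst G_eq) (auto simp: J_eq)

lemma G_pos: "1 \<le> i \<Longrightarrow> i \<le> n \<Longrightarrow> 0 < G i"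
  unfolding G_eq using J_pos resist_pos by (intro mult_pos_pos sum_pos) auto

lemma G_after: "G (Suc n) = 0"
  by (subst G_eq) auto

lemma G_diff: "1 \<le> i \<Longrightarrow> i \<le> n \<Longrightarrow> G i - G (Suc i) = J * resist i"
  by (simp add: G_eq sum.atLeast_Suc_atMost algebra_simps)

lemma G_le_1: "1 \<le> i \<Longrightarrow> G i \<le> 1"
proof -
  assume i: "1 \<le> i"
  have "(\<Sum>k=i..n. resist k) \<le> (\<Sum>k=1..n. resist k)"
    using i resist_pos by (intro sum_mono2) (auto intro: less_imp_le)
  then have "J * (\<Sum>k=i..n. resist k) \<le> J * (\<Sum>k=1..n. resist k)"
    using J_pos by (intro mult_left_mono) auto
  then show ?thesis using i G_1 G_eq[of 1] G_eq[of i] by simp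
qed

text \<open>Growth and shrinking across the edge \<open>(i, i + 1)\<close>, with their rates. When
  there is no cluster that could grow or shrink, truncation at 0 makes the new configuration
  meaningless; the rate, which is then 0, removes its contribution.\<close>

definition up :: "(nat \<Rightarrow> nat) \<Rightarrow> nat \<Rightarrow> nat \<Rightarrow> nat" where
  "up C i = BD_add C (BD_Delta i)"

definition dn :: "(nat \<Rightarrow> nat) \<Rightarrow> nat \<Rightarrow> nat \<Rightarrow> nat" where
  "dn C i = BD_add C (\<lambda>j. - BD_Delta i j)"

definition up_rate :: "(nat \<Rightarrow> nat) \<Rightarrow> nat \<Rightarrow> real" where
  "up_rate C i = a i * z * BD_conc z C i"

definition dn_rate :: "(nat \<Rightarrow> nat) \<Rightarrow> nat \<Rightarrow> real" where
  "dn_rate C i = b (Suc i) * BD_conc z C (Suc i)"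

lemma nat_int_shift: "nat (int m + 1) = m + 1" "nat (int m - 1) = m - 1" "nat (int m + - 1) = m - 1"
  by linarith+

lemma up_apply: "1 \<le> i \<Longrightarrow> up C i j =
    (if j = Suc i then C j + 1 else if j = i \<and> i \<noteq> 1 then C j - 1 else C j)"
  using nat_int_shift[of "C j"] unfolding up_def BD_add_def BD_Delta_def unit_seq_def
  by (cases "i = 1"; cases "j = Suc i"; cases "j = i") simp_all

lemma dn_apply: "1 \<le> i \<Longrightarrow> dn C i j =
    (if j = Suc i then C j - 1 else if j = i \<and> i \<noteq> 1 then C j + 1 else C j)"
  using nat_int_shift[of "C j"] unfolding dn_def BD_add_def BD_Delta_def unit_seq_def
  by (cases "i = 1"; cases "j = Suc i"; cases "j = i") simp_all

lemma rates_nonneg: "1 \<le> i \<Longrightarrow> 0 \<le> up_rate C i" "1 \<le> i \<Longrightarrow> 0 \<le> dn_rate C i"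
  using a_pos[of i] b_pos[of "Suc i"] z_pos by (auto simp: up_rate_def dn_rate_def BD_conc_def)

lemma generator_finite_sum:
  assumes C: "C \<in> A"
  shows "BD_generator a b z \<phi> C
    = (\<Sum>i=1..n. up_rate C i * (\<phi> (up C i) - \<phi> C) + dn_rate C i * (\<phi> (dn C i) - \<phi> C))"
proof -
  have z: "C i = 0" if "n < i" for i using C that by (simp add: BD_states_upto_iff)
  have "BD_generator a b z \<phi> C
    = (\<Sum>\<^sub>\<infinity>i\<in>{1..n}. up_rate C i * (\<phi> (up C i) - \<phi> C) + dn_rate C i * (\<phi> (dn C i) - \<phi> C))"
    unfolding BD_generator_def
    by (rule infsum_cong_neutral)
       (use z n_ge in \<open>auto simp: up_rate_def dn_rate_def up_def dn_def BD_conc_def\<close>)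
  then show ?thesis by simp
qed

lemma up_neq: "1 \<le> i \<Longrightarrow> up C i \<noteq> C"
proof
  assume "1 \<le> i" "up C i = C"
  then have "up C i (Suc i) = C (Suc i)" by simp
  then show False using \<open>1 \<le> i\<close> by (simp add: up_apply)
qed

lemma dn_neq: "1 \<le> i \<Longrightarrow> dn_rate C i \<noteq> 0 \<Longrightarrow> dn C i \<noteq> C"
proof
  assume i: "1 \<le> i" and "dn_rate C i \<noteq> 0" "dn C i = C"
  then have "dn C i (Suc i) = C (Suc i)" "C (Suc i) \<noteq> 0" by (auto simp: dn_rate_def BD_conc_def)
  then show False using i by (simp add: dn_apply)
qed

lemma BD_exit_rate:
  assumes C: "C \<in> A"
  shows "exit_rate (BD_generator a b z) C = (\<Sum>i=1..n. up_rate C i + dn_rate C i)"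
proof -
  have u: "up_rate C i * indicator {C} (up C i) = 0" if "1 \<le> i" for i
    using up_neq[OF that] by simp
  have d: "dn_rate C i * indicator {C} (dn C i) = 0" if "1 \<le> i" for i
    using dn_neq[OF that, of C] by (cases "dn_rate C i = 0") auto
  show ?thesis
    unfolding exit_rate_def generator_finite_sum[OF C] sum_negf[symmetric]
  proof (rule sum.cong)
    fix i assume "i \<in> {1..n}"
    then have i: "1 \<le> i" by simp
    show "- (up_rate C i * (indicator {C} (up C i) - indicator {C} C)
          + dn_rate C i * (indicator {C} (dn C i) - indicator {C} C)) = up_rate C i + dn_rate C i"
      unfolding right_diff_distrib u[OF i] d[OF i] by simp
  qed simp
qed

lemma BD_exit_rate_pos:
  assumes C: "C \<in> A" shows "0 < exit_rate (BD_generator a b z) C"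
proof -
  have "0 < up_rate C 1 + dn_rate C 1"
    using a_pos[of 1] z_pos rates_nonneg(2)[of 1 C] by (simp add: up_rate_def BD_conc_def add_pos_nonneg)
  also have "\<dots> \<le> (\<Sum>i=1..n. up_rate C i + dn_rate C i)"
    using n_ge rates_nonneg by (intro member_le_sum) (auto intro: add_nonneg_nonneg)
  finally show ?thesis unfolding BD_exit_rate[OF C] .
qed

text \<open>Meaningless targets of rate 0 may be in this set; they have jump probability 0 unless
  they coincide with a genuine target.\<close>

definition targets :: "(nat \<Rightarrow> nat) \<Rightarrow> (nat \<Rightarrow> nat) set" where
  "targets C = ((up C ` {1..n} \<union> dn C ` {1..n}) \<inter> A) - {C}"

lemma BD_jump_prob:
  assumes C: "C \<in> A" and v: "v \<in> targets C"
  shows "jump_prob (BD_generator a b z) C v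
    = (\<Sum>i=1..n. up_rate C i * indicator {v} (up C i) + dn_rate C i * indicator {v} (dn C i))
        / exit_rate (BD_generator a b z) C"
proof -
  have "v \<noteq> C" using v by (auto simp: targets_def)
  then show ?thesis
    using BD_exit_rate_pos[OF C] unfolding jump_prob_def generator_finite_sum[OF C] by simp
qed

text \<open>Distinct \<open>i\<close> may lead to the same target when rates vanish, so sums over
  targets are turned into sums over transitions by exchanging the summations.\<close>

lemma sum_jump_prob:
  assumes C: "C \<in> A"
  shows "(\<Sum>v\<in>targets C. jump_prob (BD_generator a b z) C v * \<phi> v)
    = (\<Sum>i=1..n. up_rate C i * (if up C i \<in> targets C then \<phi> (up C i) else 0)
        + dn_rate C i * (if dn C i \<in> targets C then \<phi> (dn C i) else 0))
      / exit_rate (BD_generator a b z) C" (is "_ = _ / ?q")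
proof -
  have fin: "finite (targets C)" by (simp add: targets_def)
  have delta: "(\<Sum>v\<in>targets C. indicator {v} x * \<phi> v) = (if x \<in> targets C then \<phi> x else 0)" for x
  proof -
    have "(\<Sum>v\<in>targets C. indicator {v} x * \<phi> v) = (\<Sum>v\<in>targets C. if v = x then \<phi> v else 0)"
      by (intro sum.cong) (auto simp: indicator_def)
    then show ?thesis using fin by (simp add: sum.delta)
  qed
  have "(\<Sum>v\<in>targets C. jump_prob (BD_generator a b z) C v * \<phi> v)
    = (\<Sum>v\<in>targets C. (\<Sum>i=1..n. up_rate C i * (indicator {v} (up C i) * \<phi> v)
         + dn_rate C i * (indicator {v} (dn C i) * \<phi> v)) / ?q)"
    by (intro sum.cong)
       (simp_all only: BD_jump_prob[OF C] times_divide_eq_left sum_distrib_right distrib_right mult.assoc)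
  also have "\<dots> = (\<Sum>i=1..n. \<Sum>v\<in>targets C. up_rate C i * (indicator {v} (up C i) * \<phi> v)
         + dn_rate C i * (indicator {v} (dn C i) * \<phi> v)) / ?q"
    unfolding sum_divide_distrib[symmetric] by (subst sum.swap) simp
  also have "\<dots> = (\<Sum>i=1..n. up_rate C i * (if up C i \<in> targets C then \<phi> (up C i) else 0)
        + dn_rate C i * (if dn C i \<in> targets C then \<phi> (dn C i) else 0)) / ?q"
    unfolding sum.distrib sum_distrib_left[symmetric] delta ..
  finally show ?thesis .
qed

lemma psi_up:
  assumes i: "1 \<le> i" "i < n" and Ci: "i = 1 \<or> 0 < C i"
  shows "psi (up C i) * G i = psi C * G (Suc i)"
proof (cases "i = 1")
  case True
  let ?R = "{2..n} - {2}"
  have "psi C' = G 2 ^ C' 2 * (\<Prod>j\<in>?R. G j ^ C' j)" for C'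
    unfolding psi_def using n_ge by (intro prod.remove) auto
  moreover have "(\<Prod>j\<in>?R. G j ^ up C i j) = (\<Prod>j\<in>?R. G j ^ C j)"
    using True by (intro prod.cong) (auto simp: up_apply)
  ultimately show ?thesis using True G_1 by (simp add: up_apply numeral_2_eq_2)
next
  case False
  let ?R = "{2..n} - {i} - {Suc i}"
  have "psi C' = G i ^ C' i * (G (Suc i) ^ C' (Suc i) * (\<Prod>j\<in>?R. G j ^ C' j))" for C'
  proof -
    have "psi C' = G i ^ C' i * (\<Prod>j\<in>{2..n} - {i}. G j ^ C' j)"
      unfolding psi_def using i False by (intro prod.remove) auto
    also have "(\<Prod>j\<in>{2..n} - {i}. G j ^ C' j) = G (Suc i) ^ C' (Suc i) * (\<Prod>j\<in>?R. G j ^ C' j)"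
      using i False by (intro prod.remove) auto
    finally show ?thesis .
  qed
  moreover have "(\<Prod>j\<in>?R. G j ^ up C i j) = (\<Prod>j\<in>?R. G j ^ C j)"
    using False i by (intro prod.cong) (auto simp: up_apply)
  moreover obtain m where "C i = Suc m" using Ci False by (cases "C i") auto
  ultimately show ?thesis using i False by (simp add: up_apply)
qed

text \<open>Shrinking undoes growth.\<close>

lemma psi_dn:
  assumes i: "1 \<le> i" "i < n" and Ci: "0 < C (Suc i)"
  shows "psi (dn C i) * G (Suc i) = psi C * G i"
proof -
  have "up (dn C i) i = C"
    using i Ci by (auto simp: fun_eq_iff up_apply dn_apply)
  moreover have "i = 1 \<or> 0 < dn C i i" using i by (auto simp: dn_apply)
  ultimately show ?thesis using psi_up[OF i, of "dn C i"] by simp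
qed

text \<open>For \<open>i = n\<close> the new state is outside \<open>A\<close>, and the right-hand
  side is 0 because \<open>G\<close> vanishes at \<open>n + 1\<close>.\<close>

lemma up_term:
  assumes C: "C \<in> A" and i: "1 \<le> i" "i \<le> n"
  shows "up_rate C i * (if up C i \<in> targets C then psi (up C i) else 0) = up_rate C i * (psi C * G (Suc i) / G i)"
proof (cases "up_rate C i = 0")
  case False
  then have Ci: "i = 1 \<or> 0 < C i" by (auto simp: up_rate_def BD_conc_def split: if_splits)
  have Gi: "0 < G i" using G_pos i by simp
  show ?thesis
  proof (cases "i = n")
    case True
    then have "up C i (Suc n) \<noteq> 0" using i by (simp add: up_apply)
    then have "up C i \<notin> targets C" by (auto simp: targets_def BD_states_upto_iff)
    then show ?thesis using True G_after by simp
  next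
    case False
    then have lt: "i < n" using i by simp
    have "up C i \<in> A" using C i lt Ci n_ge by (auto simp: BD_states_upto_iff up_apply)
    then have "up C i \<in> targets C" using i up_neq[OF i(1)] by (simp add: targets_def)
    moreover have "psi (up C i) = psi C * G (Suc i) / G i"
      using psi_up[where C=C, OF i(1) lt Ci] Gi by (simp add: field_simps)
    ultimately show ?thesis by simp
  qed
qed simp

text \<open>For \<open>i = n\<close> the denominator is 0, but so is the rate, as states in
  \<open>A\<close> have no cluster of size \<open>n + 1\<close>.\<close>

lemma dn_term:
  assumes C: "C \<in> A" and i: "1 \<le> i" "i \<le> n"
  shows "dn_rate C i * (if dn C i \<in> targets C then psi (dn C i) else 0) = dn_rate C i * (psi C * G i / G (Suc i))"
proof (cases "dn_rate C i = 0")
  case False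
  then have Ci: "0 < C (Suc i)" using i by (auto simp: dn_rate_def BD_conc_def)
  have lt: "i < n"
  proof (rule ccontr)
    assume "\<not> i < n"
    then have "C (Suc i) = 0" using C by (simp add: BD_states_upto_iff)
    then show False using Ci by simp
  qed
  have "dn C i \<in> A" using C i lt n_ge by (auto simp: BD_states_upto_iff dn_apply)
  then have "dn C i \<in> targets C" using i dn_neq[OF i(1) False] by (simp add: targets_def)
  moreover have "psi (dn C i) = psi C * G i / G (Suc i)"
    using psi_dn[where C=C, OF i(1) lt Ci] G_pos[of "Suc i"] lt by (simp add: field_simps)
  ultimately show ?thesis by simp
qed simp

text \<open>With \<open>h i = J c i / (Q i z^i G i)\<close>, growth out of size \<open>i\<close>
  costs \<open>h i\<close> and shrinking from size \<open>i + 1\<close> gains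
  \<open>h (i + 1)\<close>. The sum telescopes to \<open>h 1\<close>, which is \<open>J\<close>
  because \<open>c 1 = z\<close>.\<close>

lemma rate_balance:
  assumes C: "C \<in> A"
  shows "(\<Sum>i=1..n. up_rate C i * ((G i - G (Suc i)) / G i)) - (\<Sum>i=1..n. dn_rate C i * ((G i - G (Suc i)) / G (Suc i))) = J"
proof -
  define h where "h i = J * (BD_conc z C i / (Q i * z ^ i * G i))" for i
  have Qz: "0 < Q i * z ^ i" if "1 \<le> i" for i using Q_pos[OF that] z_pos by simp
  have up: "up_rate C i * ((G i - G (Suc i)) / G i) = h i" if i: "i \<in> {1..n}" for i
  proof -
    have "a i \<noteq> 0" "Q i \<noteq> 0" "z \<noteq> 0" using i a_pos[of i] Q_pos[of i] z_pos by auto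
    then show ?thesis
      using i by (simp add: G_diff up_rate_def resist_def h_def field_simps)
  qed
  have dn: "dn_rate C i * ((G i - G (Suc i)) / G (Suc i)) = h (Suc i)" if i: "i \<in> {1..n}" for i
  proof -
    have nz: "a i \<noteq> 0" "Q i \<noteq> 0" "z \<noteq> 0" "b (Suc i) \<noteq> 0"
      using i a_pos[of i] Q_pos[of i] z_pos b_pos[of "Suc i"] by auto
    have "resist i = 1 / (b (Suc i) * Q (Suc i) * z ^ Suc i)"
      using Q_step[of i] i by (simp add: resist_def)
    then show ?thesis
      using i nz by (simp add: G_diff dn_rate_def h_def field_simps)
  qed
  have "h (Suc n) = 0" by (simp add: h_def G_after)
  have "(\<Sum>i=1..n. h i) - (\<Sum>i=1..n. h (Suc i)) = h 1 - h (Suc n)"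
    using sum_natinterval_diff[of h 1 n] n_ge by (simp add: sum_subtractf)
  also have "\<dots> = J"
    using z_pos G_1 by (simp add: h_def G_after BD_conc_def)
  finally show ?thesis using up dn by simp
qed

text \<open>This is \<open>L \<psi> = - J \<psi>\<close> divided by the exit rate: a transition
  across the edge \<open>(i, i + 1)\<close> multiplies \<open>\<psi>\<close> by
  \<open>G (i + 1) / G i\<close> or its inverse, and the resulting changes balance up to
  \<open>J\<close>.\<close>

lemma psi_eigenfunction:
  assumes C: "C \<in> A"
  shows "(\<Sum>v\<in>targets C. jump_prob (BD_generator a b z) C v * psi v)
    = (1 - J / exit_rate (BD_generator a b z) C) * psi C" (is "_ = (1 - J / ?q) * _")
proof -
  have q: "0 < ?q" using C by (rule BD_exit_rate_pos)
  have tu: "up_rate C i * (psi C * G (Suc i) / G i) = psi C * (up_rate C i - up_rate C i * ((G i - G (Suc i)) / G i))"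
    if "i \<in> {1..n}" for i
    using G_pos[of i] that by (simp add: field_simps)
  have td: "dn_rate C i * (psi C * G i / G (Suc i)) = psi C * (dn_rate C i + dn_rate C i * ((G i - G (Suc i)) / G (Suc i)))"
    if "i \<in> {1..n}" for i
  proof (cases "i = n")
    case True
    then have "dn_rate C i = 0" using C n_ge by (simp add: dn_rate_def BD_conc_def BD_states_upto_iff)
    then show ?thesis by simp
  next
    case False
    then show ?thesis using G_pos[of "Suc i"] that by (simp add: field_simps)
  qed
  have "(\<Sum>i=1..n. up_rate C i * (if up C i \<in> targets C then psi (up C i) else 0)
        + dn_rate C i * (if dn C i \<in> targets C then psi (dn C i) else 0))
    = (\<Sum>i=1..n. psi C * (up_rate C i - up_rate C i * ((G i - G (Suc i)) / G i))
        + psi C * (dn_rate C i + dn_rate C i * ((G i - G (Suc i)) / G (Suc i))))"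
    using up_term[OF C] dn_term[OF C] tu td by (intro sum.cong) auto
  also have "\<dots> = (\<Sum>i=1..n. psi C * ((up_rate C i + dn_rate C i)
      - (up_rate C i * ((G i - G (Suc i)) / G i) - dn_rate C i * ((G i - G (Suc i)) / G (Suc i)))))"
    by (intro sum.cong refl) (simp only: algebra_simps)
  also have "\<dots> = psi C * ((\<Sum>i=1..n. up_rate C i + dn_rate C i)
     - ((\<Sum>i=1..n. up_rate C i * ((G i - G (Suc i)) / G i)) - (\<Sum>i=1..n. dn_rate C i * ((G i - G (Suc i)) / G (Suc i)))))"
    by (simp only: sum_subtractf sum_distrib_left[symmetric])
  also have "\<dots> = psi C * (?q - J)"
    unfolding rate_balance[OF C] BD_exit_rate[OF C] ..
  finally show ?thesis
    unfolding sum_jump_prob[OF C] using q by (simp add: field_simps)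
qed

lemma psi_bounds: "0 \<le> psi C" "psi C \<le> 1"
proof -
  have "0 \<le> G i \<and> G i \<le> 1" if "i \<in> {2..n}" for i
    using G_pos[of i] G_le_1[of i] that by simp
  then show "0 \<le> psi C" "psi C \<le> 1"
    unfolding psi_def by (auto intro!: prod_nonneg prod_le_1 power_le_one)
qed

definition clusters :: "(nat \<Rightarrow> nat) \<Rightarrow> nat" where "clusters C = (\<Sum>i=2..n. C i)"

lemma clusters_targets:
  assumes "v \<in> targets C" shows "clusters v \<le> Suc (clusters C)"
proof -
  have *: "clusters v \<le> Suc (clusters C)" if "\<And>j. v j \<le> C j + (if j = c then 1 else 0)" for c
  proof -
    have "clusters v \<le> (\<Sum>j=2..n. C j + (if j = c then 1 else 0))"
      unfolding clusters_def by (intro sum_mono that)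
    also have "\<dots> \<le> Suc (clusters C)" by (simp add: sum.distrib clusters_def)
    finally show ?thesis .
  qed
  from assms obtain i where i: "1 \<le> i" "v = up C i \<or> v = dn C i" by (auto simp: targets_def)
  from i(2) show ?thesis
  proof
    assume "v = up C i"
    then show ?thesis using i(1) by (intro *[of "Suc i"]) (auto simp: up_apply)
  next
    assume "v = dn C i"
    then show ?thesis using i(1) by (intro *[of i]) (auto simp: dn_apply)
  qed
qed

text \<open>The factor \<open>1 + z\<close> covers both \<open>c 1 = z\<close> and
  \<open>c i = C i\<close> for \<open>i \<ge> 2\<close>.\<close>

definition rate_const :: real where
  "rate_const = (\<Sum>i=1..n. a i * z * (1 + z) + b (Suc i))"

lemma rate_const_pos: "0 < rate_const"
  unfolding rate_const_def using a_pos b_pos z_pos n_ge by (intro sum_pos) (auto intro!: add_pos_pos)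

lemma BD_exit_rate_le:
  assumes C: "C \<in> A"
  shows "exit_rate (BD_generator a b z) C \<le> rate_const * (1 + real (clusters C))"
proof -
  have cl: "real (C i) \<le> real (clusters C)" for i
  proof (cases "i \<in> {2..n}")
    case True
    then have "C i \<le> clusters C" unfolding clusters_def by (intro member_le_sum) auto
    then show ?thesis by simp
  next
    case False
    then have "C i = 0" using C by (cases "i = 0 \<or> i = 1") (auto simp: BD_states_upto_iff)
    then show ?thesis by simp
  qed
  have "up_rate C i + dn_rate C i \<le> (a i * z * (1 + z) + b (Suc i)) * (1 + real (clusters C))"
    if i: "i \<in> {1..n}" for i
  proof -
    have "BD_conc z C i \<le> (1 + z) * (1 + real (clusters C))"
    proof (cases "i = 1")
      case True
      have "0 \<le> z * real (clusters C)" using z_pos by simp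
      then show ?thesis using True by (simp add: BD_conc_def algebra_simps)
    next
      case False
      have "real (C i) \<le> 1 * (1 + real (clusters C))" using cl[of i] by simp
      also have "\<dots> \<le> (1 + z) * (1 + real (clusters C))" using z_pos by (intro mult_right_mono) auto
      finally show ?thesis using False by (simp add: BD_conc_def)
    qed
    then have "a i * z * BD_conc z C i \<le> a i * z * ((1 + z) * (1 + real (clusters C)))"
      using a_pos[of i] z_pos i by (intro mult_left_mono) auto
    moreover have "BD_conc z C (Suc i) \<le> 1 + real (clusters C)"
      using i cl[of "Suc i"] by (simp add: BD_conc_def)
    then have "b (Suc i) * BD_conc z C (Suc i) \<le> b (Suc i) * (1 + real (clusters C))"
      using b_pos[of "Suc i"] i by (intro mult_left_mono) auto
    ultimately show ?thesis by (simp add: up_rate_def dn_rate_def algebra_simps)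
  qed
  then show ?thesis
    unfolding BD_exit_rate[OF C] rate_const_def sum_distrib_right by (intro sum_mono) auto
qed

lemma BD_killed_chain:
  assumes "jump_holding_chain M BD_states (BD_generator a b z) \<mu> X Y H"
  shows "killed_chain M BD_states (BD_generator a b z) \<mu> X Y H A targets clusters psi rate_const J"
proof -
  interpret jump_holding_chain M BD_states "BD_generator a b z" \<mu> X Y H by fact
  show ?thesis
  proof (unfold_locales, goal_cases)
    case 1
    show ?case by (auto simp: BD_states_upto_def)
  next
    case (7 C v)
    have "0 < exit_rate (BD_generator a b z) C" using 7 by (intro BD_exit_rate_pos)
    then show ?case unfolding BD_jump_prob[OF 7] using rates_nonneg
      by (intro divide_nonneg_pos sum_nonneg add_nonneg_nonneg mult_nonneg_nonneg) auto
  next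
    case (8 C)
    have q: "0 < exit_rate (BD_generator a b z) C" using 8 by (rule BD_exit_rate_pos)
    have "(\<Sum>v\<in>targets C. jump_prob (BD_generator a b z) C v) = (\<Sum>v\<in>targets C. jump_prob (BD_generator a b z) C v * 1)"
      by simp
    also have "\<dots> \<le> (\<Sum>i=1..n. up_rate C i + dn_rate C i) / exit_rate (BD_generator a b z) C"
      unfolding sum_jump_prob[OF 8] using q rates_nonneg
      by (intro divide_right_mono sum_mono add_mono) auto
    also have "\<dots> = 1" using q unfolding BD_exit_rate[OF 8, symmetric] by simp
    finally show ?case .
  qed (use BD_exit_rate_pos BD_exit_rate_le clusters_targets psi_bounds psi_eigenfunction rate_const_pos J_pos
     in \<open>auto simp: targets_def\<close>)
qed

lemma BD_G_eq:
  assumes "set_pmf \<mu> \<subseteq> A"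
  shows "BD_G a b z n \<mu> = measure_pmf.expectation \<mu> psi"
  unfolding BD_G_def
proof (rule integral_cong_AE)
  have "(\<Prod>i=1..n. G i powr BD_conc z C i) = psi C" for C
  proof -
    have "(\<Prod>i=1..n. G i powr BD_conc z C i) = G 1 powr BD_conc z C 1 * (\<Prod>i=2..n. G i powr BD_conc z C i)"
      using n_ge by (subst prod.atLeast_Suc_atMost) (auto simp: numeral_2_eq_2)
    also have "(\<Prod>i=2..n. G i powr BD_conc z C i) = psi C"
      unfolding psi_def using G_pos by (intro prod.cong) (auto simp: BD_conc_def powr_realpow)
    finally show ?thesis using G_1 by simp
  qed
  then show "AE C in measure_pmf \<mu>. (\<Prod>i=1..n. (BD_f a b z n i / (Q i * z ^ i)) powr BD_conc z C i) = psi C"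
    by (simp add: G_def)
qed auto

lemma expectation_psi_ge:
  assumes supp: "set_pmf \<mu> \<subseteq> A"
    and int: "integrable (measure_pmf \<mu>) (\<lambda>C. \<Sum>\<^sub>\<infinity>i\<in>{2..}. real (C i))"
  shows "1 - (\<Sum>i=2..n. measure_pmf.expectation \<mu> (\<lambda>C. real (C i)) * (1 - G i)) \<le> measure_pmf.expectation \<mu> psi"
proof -
  have inf_sum: "(\<Sum>\<^sub>\<infinity>i\<in>{2..}. real (C i)) = real (clusters C)" if "C \<in> A" for C
  proof -
    have "(\<Sum>\<^sub>\<infinity>i\<in>{2..}. real (C i)) = (\<Sum>\<^sub>\<infinity>i\<in>{2..n}. real (C i))"
      by (rule infsum_cong_neutral) (use that in \<open>auto simp: BD_states_upto_iff\<close>)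
    then show ?thesis by (simp add: clusters_def)
  qed
  have int_i: "integrable (measure_pmf \<mu>) (\<lambda>C. real (C i))" if i: "i \<in> {2..n}" for i
  proof (rule Bochner_Integration.integrable_bound[OF int])
    show "AE C in measure_pmf \<mu>. norm (real (C i)) \<le> norm (\<Sum>\<^sub>\<infinity>i\<in>{2..}. real (C i))"
    proof (subst AE_measure_pmf_iff, intro ballI)
      fix C assume "C \<in> set_pmf \<mu>"
      then have "C \<in> A" using supp by auto
      moreover have "C i \<le> clusters C" unfolding clusters_def using i by (intro member_le_sum) auto
      ultimately show "norm (real (C i)) \<le> norm (\<Sum>\<^sub>\<infinity>i\<in>{2..}. real (C i))" by (simp add: inf_sum)
    qed
  qed simp
  have "1 - (\<Sum>i=2..n. measure_pmf.expectation \<mu> (\<lambda>C. real (C i)) * (1 - G i))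
    = measure_pmf.expectation \<mu> (\<lambda>C. 1 - (\<Sum>i=2..n. real (C i) * (1 - G i)))"
    using int_i by (subst Bochner_Integration.integral_diff) (auto intro!: Bochner_Integration.integrable_sum simp: Bochner_Integration.integral_sum)
  also have "\<dots> \<le> measure_pmf.expectation \<mu> psi"
  proof (rule integral_mono)
    show "integrable (measure_pmf \<mu>) (\<lambda>C. 1 - (\<Sum>i=2..n. real (C i) * (1 - G i)))"
      using int_i by (intro Bochner_Integration.integrable_diff Bochner_Integration.integrable_sum) auto
    show "integrable (measure_pmf \<mu>) psi"
      using psi_bounds by (intro measure_pmf.integrable_const_bound[where B=1]) auto
    show "1 - (\<Sum>i=2..n. real (C i) * (1 - G i)) \<le> psi C" for C
      unfolding psi_def using G_pos G_le_1 by (intro prod_power_ge_1_minus_sum) (auto intro: less_imp_le)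
  qed
  finally show ?thesis .
qed

end

section \<open>The exit-time bound\<close>

theorem theorem6p1:
  fixes a b :: "nat \<Rightarrow> real" and z z\<^sub>s :: real and n :: nat
    and \<mu> :: "(nat \<Rightarrow> nat) pmf"
    and M :: "'w measure" and X :: "real \<Rightarrow> 'w \<Rightarrow> (nat \<Rightarrow> nat) option"
  assumes "\<And>i. i \<ge> 1 \<Longrightarrow> a i > 0"
    and "\<And>i. i \<ge> 2 \<Longrightarrow> b i > 0"
    and "(\<lambda>i. b i / a i) \<longlonglongrightarrow> z\<^sub>s"
    and "z\<^sub>s > 0"
    and "(\<lambda>i. b (i + 1) / b i) \<longlonglongrightarrow> 1"
    and "z > z\<^sub>s"
    and "(\<Sum>\<^sub>\<infinity>m\<in>{2..}. ennreal (BD_Q a b m * z ^ m)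
            * (\<Sum>\<^sub>\<infinity>k\<in>{m..}. ennreal (1 / (a k * BD_Q a b k * z ^ (k + 1))))) = \<infinity>"
    and "n \<ge> 2"
    and "set_pmf \<mu> \<subseteq> BD_states_upto n"
    and "integrable (measure_pmf \<mu>) (\<lambda>C. \<Sum>\<^sub>\<infinity>i\<in>{2..}. real (C i))"
    and "markov_chain M BD_states (BD_generator a b z) \<mu> X"
  shows "(\<forall>t\<ge>0. measure M {\<omega> \<in> space M. exit_time (BD_states_upto n) X \<omega> > ereal t}
                   \<ge> BD_G a b z n \<mu> * exp (- BD_J a b z n * t))
         \<and> BD_G a b z n \<mu>
             \<ge> 1 - (\<Sum>i=2..n. measure_pmf.expectation \<mu> (\<lambda>C. real (C i))
                                 * (1 - BD_f a b z n i / (BD_Q a b i * z ^ i)))"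
proof -
  interpret BD_cutoff a b z n
    using assms by unfold_locales auto
  obtain Y H where "jump_holding_chain M BD_states (BD_generator a b z) \<mu> X Y H"
    using markov_chain_jump_holding[OF assms(11)] .
  then interpret killed_chain M BD_states "BD_generator a b z" \<mu> X Y H
    "BD_states_upto n" targets clusters psi rate_const "BD_J a b z n"
    by (rule BD_killed_chain)
  show ?thesis
    using survival_lower_bound[OF _ assms(9)] expectation_psi_ge[OF assms(9,10)]
    unfolding BD_G_eq[OF assms(9)] G_def by blast
qed

end
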